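(* Let $(G,L)$ be an uncolorable pair. Then: (a) $|L(v)|=d_G(v)$ for all $v\in V(G)$. (b) Any two adjacent vertices are joined by exactly one edge or by a pair of differently signed parallel edges. (c) If $G$ is a block (i.e. $G$ has no separating vertex), then every edge $e$ with ends $v,w$ satisfies $L(v)=\sigma(e)L(w)$. Furthermore: (c1) if all edges of $G$ are positive, there is a color set $C$ with $L(v)=C$ for all $v\in V(G)$; (c2) if $G$ has a negative edge, then either there is a symmetric color set $C$ (i.e. $C=-C$) with $L(v)=C$ for all $v\in V(G)$, or $G$ is balanced with parts $X,Y$ and there is a color set $C$ with $L(v)=C$ for all $v\in X$ and $L(v)=-C$ for all $v\in Y$. As a consequence, $G$ is regular. (d) If $G$ is a block with $\mu(G)\ge2$, then $G$ is $r$-regular for an even number $r\ge2$. (e) Every block of $G$ is a brick.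
   Context: A signed graph is a finite graph (multiple edges allowed, no loops) with a sign map $\sigma$ assigning $\pm1$ to each edge; degrees count edges with multiplicity, and $\mu(G)$ is the maximum number of edges joining two vertices. A coloring is a map $\phi:V(G)\to\mathbb{Z}$ with $\phi(v)\ne\sigma(e)\phi(w)$ for every edge $e$ with ends $v,w$. A list-assignment $L$ assigns a set $L(v)\subseteq\mathbb{Z}$ to each vertex; an $L$-coloring is a coloring with $\phi(v)\in L(v)$. For $C\subseteq\mathbb{Z}$, $-C=\{-c:c\in C\}$ and $1\cdot C=C$. An uncolorable pair is a pair $(G,L)$ where $G$ is a connected signed graph, $L$ is a list-assignment with $|L(v)|\ge d_G(v)$ for all $v$, and $G$ is not $L$-colorable. $G$ is balanced with parts $X,Y$ if $V(G)=X\cup Y$ disjointly and an edge is negative iff it joins $X$ and $Y$; $G$ is balanced if every cycle has positive sign product (product of its edge signs), equivalently if it is balanced with some parts. A block of $G$ is a maximal connected subgraph without a separating vertex. A brick is one of: a balanced complete graph (underlying graph a simple $K_n$, $n\ge1$); a balanced odd cycle; an unbalanced even cycle; $2K_n$ for $n\ge2$; $2C_n$ for odd $n\ge3$, where a cycle is a signed graph whose underlying graph is a cycle and $2H$ (for a simple graph $H$) is obtained by replacing each edge of $H$ by a positive and a negative parallel edge. *)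

theory Defs
  imports Main
begin

record ('v, 'e) sgraph =
  verts :: "'v set"
  edges :: "'e set"
  ends :: "'e \<Rightarrow> 'v set"
  sign :: "'e \<Rightarrow> int"

locale signed_graph =
  fixes G :: "('v, 'e) sgraph"
  assumes finite_verts: "finite (verts G)"
    and finite_edges: "finite (edges G)"
    and ends_verts: "e \<in> edges G \<Longrightarrow> ends G e \<subseteq> verts G"
    and card_ends: "e \<in> edges G \<Longrightarrow> card (ends G e) = 2"
    and sign_values: "e \<in> edges G \<Longrightarrow> sign G e = 1 \<or> sign G e = -1"

definition edges_between :: "('v, 'e) sgraph \<Rightarrow> 'v \<Rightarrow> 'v \<Rightarrow> 'e set" where
  "edges_between G v w = {e \<in> edges G. ends G e = {v, w}}"

definition adjacent :: "('v, 'e) sgraph \<Rightarrow> 'v \<Rightarrow> 'v \<Rightarrow> bool" where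
  "adjacent G v w \<longleftrightarrow> edges_between G v w \<noteq> {}"

definition degree :: "('v, 'e) sgraph \<Rightarrow> 'v \<Rightarrow> nat" where
  "degree G v = card {e \<in> edges G. v \<in> ends G e}"

definition regular :: "('v, 'e) sgraph \<Rightarrow> nat \<Rightarrow> bool" where
  "regular G r \<longleftrightarrow> (\<forall>v\<in>verts G. degree G v = r)"

text \<open>Pairs with \<open>v = w\<close> contribute 0, as there are no loops; they keep the set nonempty
  when \<open>G\<close> has a single vertex.\<close>

definition max_multiplicity :: "('v, 'e) sgraph \<Rightarrow> nat" where
  "max_multiplicity G = Max {card (edges_between G v w) |v w. v \<in> verts G \<and> w \<in> verts G}"

definition reachable :: "('v, 'e) sgraph \<Rightarrow> ('v \<times> 'v) set" where
  "reachable G = {(v, w). v \<in> verts G \<and> w \<in> verts G \<and> (adjacent G)\<^sup>*\<^sup>* v w}"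

definition components :: "('v, 'e) sgraph \<Rightarrow> 'v set set" where
  "components G = verts G // reachable G"

definition connected :: "('v, 'e) sgraph \<Rightarrow> bool" where
  "connected G \<longleftrightarrow> verts G \<noteq> {} \<and> (\<forall>v\<in>verts G. \<forall>w\<in>verts G. (v, w) \<in> reachable G)"

definition delete_vertex :: "('v, 'e) sgraph \<Rightarrow> 'v \<Rightarrow> ('v, 'e) sgraph" where
  "delete_vertex G v =
     G\<lparr>verts := verts G - {v}, edges := {e \<in> edges G. v \<notin> ends G e}\<rparr>"

definition separating_vertex :: "('v, 'e) sgraph \<Rightarrow> 'v \<Rightarrow> bool" where
  "separating_vertex G v \<longleftrightarrow>
     v \<in> verts G \<and> card (components (delete_vertex G v)) > card (components G)"

definition is_block :: "('v, 'e) sgraph \<Rightarrow> bool" where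
  "is_block G \<longleftrightarrow> connected G \<and> \<not> (\<exists>v. separating_vertex G v)"

text \<open>A subgraph keeps the end and sign maps of the whole graph, as total functions, so that
  subgraphs with the same vertices and edges are equal as records.\<close>

definition subgraph :: "('v, 'e) sgraph \<Rightarrow> ('v, 'e) sgraph \<Rightarrow> bool" where
  "subgraph H G \<longleftrightarrow>
     verts H \<subseteq> verts G \<and> edges H \<subseteq> edges G \<and> ends H = ends G \<and> sign H = sign G \<and>
     (\<forall>e\<in>edges H. ends H e \<subseteq> verts H)"

definition block_of :: "('v, 'e) sgraph \<Rightarrow> ('v, 'e) sgraph \<Rightarrow> bool" where
  "block_of B G \<longleftrightarrow>
     subgraph B G \<and> is_block B \<and>
     (\<forall>H. subgraph H G \<and> is_block H \<and> subgraph B H \<longrightarrow> H = B)"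

text \<open>Two parallel edges form a cycle of length 2, so a pair of oppositely signed parallel
  edges is an unbalanced cycle.\<close>

definition is_cycle_in :: "('v, 'e) sgraph \<Rightarrow> 'v list \<Rightarrow> 'e list \<Rightarrow> bool" where
  "is_cycle_in G vs es \<longleftrightarrow>
     length vs \<ge> 2 \<and> length es = length vs \<and> distinct vs \<and> distinct es \<and>
     set es \<subseteq> edges G \<and>
     (\<forall>i<length vs. ends G (es ! i) = {vs ! i, vs ! (Suc i mod length vs)})"

definition balanced :: "('v, 'e) sgraph \<Rightarrow> bool" where
  "balanced G \<longleftrightarrow> (\<forall>vs es. is_cycle_in G vs es \<longrightarrow> (\<Prod>e\<in>set es. sign G e) = 1)"

definition balanced_with_parts :: "('v, 'e) sgraph \<Rightarrow> 'v set \<Rightarrow> 'v set \<Rightarrow> bool" where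
  "balanced_with_parts G X Y \<longleftrightarrow>
     X \<union> Y = verts G \<and> X \<inter> Y = {} \<and>
     (\<forall>e\<in>edges G. sign G e = -1 \<longleftrightarrow> (\<exists>x\<in>X. \<exists>y\<in>Y. ends G e = {x, y}))"

text \<open>A simple graph on a given vertex set is represented by its set of two-element edges.\<close>

definition complete_edges :: "'v set \<Rightarrow> 'v set set" where
  "complete_edges V = {A. A \<subseteq> V \<and> card A = 2}"

definition cycle_edges :: "'v list \<Rightarrow> 'v set set" where
  "cycle_edges vs = {{vs ! i, vs ! (Suc i mod length vs)} |i. i < length vs}"

definition underlying_simple :: "('v, 'e) sgraph \<Rightarrow> 'v set set \<Rightarrow> bool" where
  "underlying_simple G S \<longleftrightarrow> inj_on (ends G) (edges G) \<and> ends G ` edges G = S"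

text \<open>\<open>is_double G S\<close>: \<open>G\<close> is \<open>2H\<close>, where \<open>H\<close> is the simple graph on the vertices of \<open>G\<close>
  with edge set \<open>S\<close>.\<close>

definition is_double :: "('v, 'e) sgraph \<Rightarrow> 'v set set \<Rightarrow> bool" where
  "is_double G S \<longleftrightarrow>
     ends G ` edges G = S \<and>
     (\<forall>A\<in>S. (\<exists>!e. e \<in> edges G \<and> ends G e = A \<and> sign G e = 1) \<and>
             (\<exists>!e. e \<in> edges G \<and> ends G e = A \<and> sign G e = -1))"

definition is_cycle :: "('v, 'e) sgraph \<Rightarrow> nat \<Rightarrow> bool" where
  "is_cycle G n \<longleftrightarrow>
     (\<exists>vs es. is_cycle_in G vs es \<and> set vs = verts G \<and> set es = edges G \<and> length vs = n)"

definition is_complete :: "('v, 'e) sgraph \<Rightarrow> nat \<Rightarrow> bool" where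
  "is_complete G n \<longleftrightarrow> card (verts G) = n \<and> underlying_simple G (complete_edges (verts G))"

definition is_double_complete :: "('v, 'e) sgraph \<Rightarrow> nat \<Rightarrow> bool" where
  "is_double_complete G n \<longleftrightarrow> card (verts G) = n \<and> is_double G (complete_edges (verts G))"

definition is_double_cycle :: "('v, 'e) sgraph \<Rightarrow> nat \<Rightarrow> bool" where
  "is_double_cycle G n \<longleftrightarrow>
     (\<exists>vs. distinct vs \<and> set vs = verts G \<and> length vs = n \<and> is_double G (cycle_edges vs))"

definition brick :: "('v, 'e) sgraph \<Rightarrow> bool" where
  "brick G \<longleftrightarrow> signed_graph G \<and>
     ((\<exists>n\<ge>1. is_complete G n \<and> balanced G) \<or>
      (\<exists>n. odd n \<and> is_cycle G n \<and> balanced G) \<or>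
      (\<exists>n. even n \<and> is_cycle G n \<and> \<not> balanced G) \<or>
      (\<exists>n\<ge>2. is_double_complete G n) \<or>
      (\<exists>n\<ge>3. odd n \<and> is_double_cycle G n))"

definition coloring :: "('v, 'e) sgraph \<Rightarrow> ('v \<Rightarrow> int) \<Rightarrow> bool" where
  "coloring G \<phi> \<longleftrightarrow>
     (\<forall>e\<in>edges G. \<forall>v w. ends G e = {v, w} \<longrightarrow> \<phi> v \<noteq> sign G e * \<phi> w)"

definition list_coloring :: "('v, 'e) sgraph \<Rightarrow> ('v \<Rightarrow> int set) \<Rightarrow> ('v \<Rightarrow> int) \<Rightarrow> bool" where
  "list_coloring G L \<phi> \<longleftrightarrow> coloring G \<phi> \<and> (\<forall>v\<in>verts G. \<phi> v \<in> L v)"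

definition list_colorable :: "('v, 'e) sgraph \<Rightarrow> ('v \<Rightarrow> int set) \<Rightarrow> bool" where
  "list_colorable G L \<longleftrightarrow> (\<exists>\<phi>. list_coloring G L \<phi>)"

text \<open>Lists may be infinite, and \<open>card\<close> is 0 on infinite sets; hence the first disjunct.\<close>

definition uncolorable_pair :: "('v, 'e) sgraph \<Rightarrow> ('v \<Rightarrow> int set) \<Rightarrow> bool" where
  "uncolorable_pair G L \<longleftrightarrow>
     signed_graph G \<and> connected G \<and>
     (\<forall>v\<in>verts G. infinite (L v) \<or> card (L v) \<ge> degree G v) \<and>
     \<not> list_colorable G L"

definition scale_colors :: "int \<Rightarrow> int set \<Rightarrow> int set" where
  "scale_colors s C = (\<lambda>c. s * c) ` C"

end

theory Submission
  imports Defs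
begin

text \<open>
  Colouring a non-separating vertex \<open>v\<close> with \<open>c\<close> and deleting the colours it forbids from the lists
  of its neighbours preserves uncolorability, and a list that is larger than the degree anywhere
  lets a greedy colouring succeed. So the lists are tight, all forbidden colours must be distinct
  members of the lists, and adjacent non-separating vertices have equal degrees. Moreover every
  connected induced subgraph inherits uncolorability (for some lists); in particular every
  2-connected induced subgraph is regular.

  This hereditary regularity determines the underlying graph of a block. Given a 2-connected proper
  vertex subset \<open>W\<close> with at least three elements, take a minimal connected set \<open>P\<close> outside \<open>W\<close>
  attached to at least two vertices of \<open>W\<close>: equality of degrees in \<open>W\<close> and in \<open>W \<union> P\<close> forces \<open>P\<close> to
  be attached to all of \<open>W\<close>, which for minimal \<open>P\<close> means that \<open>P\<close> is a single vertex dominating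
  \<open>W\<close>. Applied to a maximal clique or to a shortest cycle, this shows that a block is complete or a
  chordless cycle. The multiplicities are then constant, by regularity of triangles and by parity,
  and the signs are read off from explicit colourings of cycles.
\<close>

section \<open>Degrees, connectivity and list colorings relative to a vertex set\<close>

definition mult :: "('v, 'e) sgraph \<Rightarrow> 'v \<Rightarrow> 'v \<Rightarrow> nat" where
  "mult G v w = card (edges_between G v w)"

text \<open>Summing multiplicities makes the degree additive over disjoint vertex sets. The vertex
  may lie outside \<open>W\<close>; the sum then counts its edges into \<open>W\<close>.\<close>

definition deg_in :: "('v, 'e) sgraph \<Rightarrow> 'v set \<Rightarrow> 'v \<Rightarrow> nat" where
  "deg_in G W v = (\<Sum>w\<in>W. mult G v w)"

text \<open>Connectivity of an induced subgraph in terms of cuts; the empty set counts as connected.\<close>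

definition conn :: "('v, 'e) sgraph \<Rightarrow> 'v set \<Rightarrow> bool" where
  "conn G S \<longleftrightarrow> (\<forall>A. A \<subseteq> S \<and> A \<noteq> {} \<and> A \<noteq> S \<longrightarrow> (\<exists>a\<in>A. \<exists>b\<in>S - A. adjacent G a b))"

text \<open>A single vertex and a pair of adjacent vertices qualify, so this describes blocks and
  not only 2-connected graphs on three or more vertices.\<close>

definition two_conn :: "('v, 'e) sgraph \<Rightarrow> 'v set \<Rightarrow> bool" where
  "two_conn G S \<longleftrightarrow> S \<noteq> {} \<and> conn G S \<and> (\<forall>v\<in>S. conn G (S - {v}))"

definition proper_on :: "('v, 'e) sgraph \<Rightarrow> 'v set \<Rightarrow> ('v \<Rightarrow> int) \<Rightarrow> bool" where
  "proper_on G W \<phi> \<longleftrightarrow>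
     (\<forall>v\<in>W. \<forall>w\<in>W. \<forall>e\<in>edges_between G v w. \<phi> v \<noteq> sign G e * \<phi> w)"

definition colorable_on :: "('v, 'e) sgraph \<Rightarrow> 'v set \<Rightarrow> ('v \<Rightarrow> int set) \<Rightarrow> bool" where
  "colorable_on G W L \<longleftrightarrow> (\<exists>\<phi>. proper_on G W \<phi> \<and> (\<forall>v\<in>W. \<phi> v \<in> L v))"

definition large_lists :: "('v, 'e) sgraph \<Rightarrow> 'v set \<Rightarrow> ('v \<Rightarrow> int set) \<Rightarrow> bool" where
  "large_lists G W L \<longleftrightarrow> (\<forall>v\<in>W. infinite (L v) \<or> deg_in G W v \<le> card (L v))"

text \<open>The notion of an uncolorable pair for the subgraph induced by \<open>W\<close>. Keeping
  \<open>G\<close> fixed and varying \<open>W\<close> lets inductions delete vertices without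
  building new graphs.\<close>

definition critical :: "('v, 'e) sgraph \<Rightarrow> 'v set \<Rightarrow> ('v \<Rightarrow> int set) \<Rightarrow> bool" where
  "critical G W L \<longleftrightarrow> W \<subseteq> verts G \<and> W \<noteq> {} \<and> conn G W \<and> large_lists G W L \<and>
     \<not> colorable_on G W L"

text \<open>What remains of the lists once \<open>v\<close> has color \<open>c\<close>. A sign is
  its own inverse, so an edge \<open>e\<close> between \<open>v\<close> and \<open>w\<close> forbids
  exactly the color \<open>sign G e * c\<close> at \<open>w\<close>.\<close>

definition residual ::
    "('v, 'e) sgraph \<Rightarrow> ('v \<Rightarrow> int set) \<Rightarrow> 'v \<Rightarrow> int \<Rightarrow> 'v \<Rightarrow> int set" where
  "residual G L v c = (\<lambda>w. L w - (\<lambda>e. sign G e * c) ` edges_between G v w)"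

section \<open>Connectivity inside a vertex set\<close>

lemma edges_between_commute: "edges_between G v w = edges_between G w v"
  by (simp add: edges_between_def insert_commute)

lemma mult_commute: "mult G v w = mult G w v"
  by (simp add: mult_def edges_between_commute)

lemma adjacent_commute: "adjacent G v w \<longleftrightarrow> adjacent G w v"
  by (simp add: adjacent_def edges_between_commute)

lemma connI:
  assumes "\<And>A. A \<subseteq> S \<Longrightarrow> A \<noteq> {} \<Longrightarrow> A \<noteq> S \<Longrightarrow> \<exists>a\<in>A. \<exists>b\<in>S - A. adjacent G a b"
  shows "conn G S"
  using assms by (simp add: conn_def)

lemma connE:
  assumes "conn G S" "A \<subseteq> S" "A \<noteq> {}" "A \<noteq> S"
  obtains a b where "a \<in> A" "b \<in> S" "b \<notin> A" "adjacent G a b"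
  using assms unfolding conn_def by (metis DiffD1 DiffD2)

lemma conn_singleton: "conn G {x}"
  by (auto simp: conn_def)

lemma conn_empty: "conn G {}"
  by (auto simp: conn_def)

lemma conn_Un:
  assumes A: "conn G A" and B: "conn G B" and ab: "a \<in> A" "b \<in> B" "adjacent G a b"
  shows "conn G (A \<union> B)"
proof (rule connI)
  fix T assume T: "T \<subseteq> A \<union> B" "T \<noteq> {}" "T \<noteq> A \<union> B"
  \<comment> \<open>A proper nonempty part \<open>T\<close> of the union either cuts
    \<open>A\<close> or \<open>B\<close>, whose own connectivity gives the crossing edge, or equals
    one of them, and then the edge between \<open>a\<close> and \<open>b\<close> crosses.\<close>
  consider (1) "T \<inter> A \<noteq> {}" "T \<inter> A \<noteq> A" | (2) "T \<inter> B \<noteq> {}" "T \<inter> B \<noteq> B"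
    | (3) "T \<inter> A = A" "T \<inter> B = {}" | (4) "T \<inter> A = {}" "T \<inter> B = B"
    using T by blast
  then show "\<exists>a\<in>T. \<exists>b\<in>A \<union> B - T. adjacent G a b"
  proof cases
    case 1
    then show ?thesis using connE[OF A, of "T \<inter> A"] by (metis DiffI Int_iff UnI1 inf_le2)
  next
    case 2
    then show ?thesis using connE[OF B, of "T \<inter> B"] by (metis DiffI Int_iff UnI2 inf_le2)
  next
    case 3
    then show ?thesis using ab by blast
  next
    case 4
    then show ?thesis using ab adjacent_commute[of G a b] by blast
  qed
qed

lemma conn_insert:
  assumes "conn G S" "x \<in> S" "adjacent G x y"
  shows "conn G (insert y S)"
  using conn_Un[OF assms(1) conn_singleton assms(2) _ assms(3), of y] by simp

lemma conn_mono_edges: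
  assumes "conn G S" "\<And>a b. a \<in> S \<Longrightarrow> b \<in> S \<Longrightarrow> adjacent G a b \<Longrightarrow> adjacent H a b"
  shows "conn H S"
  using assms unfolding conn_def by (metis DiffD1 subset_iff)

lemma conn_neighbor:
  assumes "conn G W" "v \<in> W" "W \<noteq> {v}"
  obtains w where "w \<in> W" "w \<noteq> v" "adjacent G v w"
  using connE[OF assms(1), of "{v}"] assms by blast

text \<open>A maximal connected proper subset of \<open>W\<close> containing \<open>W0\<close> can
  be extended by an adjacent vertex of \<open>W\<close>. By maximality the extension is all of
  \<open>W\<close>, so that vertex was the only one missing. With a singleton \<open>W0\<close> this
  gives a non-separating vertex other than a prescribed one.\<close>

lemma exists_removable_vertex:
  assumes "finite W" "conn G W" "W0 \<subseteq> W" "W0 \<noteq> W" "W0 \<noteq> {}" "conn G W0"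
  obtains v where "v \<in> W - W0" "conn G (W - {v})"
proof -
  define F where "F = {S. W0 \<subseteq> S \<and> S \<subset> W \<and> conn G S}"
  have "finite F" by (rule finite_subset[of _ "Pow W"]) (use assms in \<open>auto simp: F_def\<close>)
  moreover have "W0 \<in> F" using assms by (auto simp: F_def)
  ultimately obtain S where "S \<in> F" and max: "\<And>T. T \<in> F \<Longrightarrow> S \<subseteq> T \<Longrightarrow> S = T"
    using finite_has_maximal[of F] by auto
  then have S: "W0 \<subseteq> S" "S \<subset> W" "conn G S" by (auto simp: F_def)
  obtain a b where ab: "a \<in> S" "b \<in> W" "b \<notin> S" "adjacent G a b"
    using connE[OF assms(2), of S] S assms(5) by blast
  have "conn G (insert b S)" using conn_insert[of G S a b] S ab by blast
  then have "insert b S = W" using max[of "insert b S"] S ab by (auto simp: F_def)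
  then have "W - {b} = S" using ab by blast
  then show ?thesis using that[of b] ab S by blast
qed

section \<open>Uncolorability of induced subgraphs\<close>

context signed_graph
begin

lemma finite_edges_between: "finite (edges_between G v w)"
  using finite_edges by (simp add: edges_between_def)

lemma edges_between_refl: "edges_between G v v = {}"
  using card_ends by (fastforce simp: edges_between_def)

lemma mult_refl: "mult G v v = 0"
  by (simp add: mult_def edges_between_refl)

lemma adjacent_iff_mult: "adjacent G v w \<longleftrightarrow> mult G v w > 0"
  using finite_edges_between by (simp add: adjacent_def mult_def card_gt_0_iff)

lemma adjacent_irrefl: "\<not> adjacent G v v"
  by (simp add: adjacent_iff_mult mult_refl)

lemma sign_mult_self: "e \<in> edges G \<Longrightarrow> sign G e * (sign G e * c) = c"
  using sign_values[of e] by auto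

lemma edges_betweenD: "e \<in> edges_between G v w \<Longrightarrow> e \<in> edges G \<and> ends G e = {v, w}"
  by (simp add: edges_between_def)

lemma adjacent_verts: "adjacent G v w \<Longrightarrow> v \<in> verts G \<and> w \<in> verts G"
  using ends_verts by (fastforce simp: adjacent_def edges_between_def)

lemma degree_eq_deg_in: "degree G v = deg_in G (verts G) v"
proof -
  have "{e \<in> edges G. v \<in> ends G e} = (\<Union>w\<in>verts G. edges_between G v w)" (is "?A = ?B")
  proof
    show "?A \<subseteq> ?B"
    proof
      fix e assume e: "e \<in> ?A"
      then obtain x y where "ends G e = {x, y}" using card_ends by (metis (no_types, lifting) card_2_iff mem_Collect_eq)
      then show "e \<in> ?B" using e ends_verts[of e] by (auto simp: edges_between_def insert_commute)
    qed
  qed (auto simp: edges_between_def)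
  moreover have "card ?B = (\<Sum>w\<in>verts G. card (edges_between G v w))"
    by (rule card_UN_disjoint)
      (use finite_verts finite_edges_between in \<open>auto simp: edges_between_def doubleton_eq_iff\<close>)
  ultimately show ?thesis by (simp add: degree_def deg_in_def mult_def)
qed

lemma deg_in_remove:
  assumes "finite W" "v \<in> W"
  shows "deg_in G W w = mult G w v + deg_in G (W - {v}) w"
  using assms by (simp add: deg_in_def sum.remove)

lemma deg_in_pos:
  assumes "finite W" "conn G W" "v \<in> W" "W \<noteq> {v}"
  shows "deg_in G W v > 0"
proof -
  obtain w where "w \<in> W" "adjacent G v w" using conn_neighbor[OF assms(2-4)] by blast
  then show ?thesis
    using deg_in_remove[OF assms(1), of w v] by (simp add: adjacent_iff_mult)
qed

lemma residual_card:
  assumes "finite (L w)"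
  shows "card (L w) \<le> mult G w v + card (residual G L v c w)"
proof -
  let ?I = "(\<lambda>e. sign G e * c) ` edges_between G v w"
  have "card ?I \<le> mult G w v"
    using card_image_le[OF finite_edges_between, of _ v w]
    by (simp add: mult_def edges_between_commute[of G w v])
  moreover have "card (L w) - card ?I \<le> card (L w - ?I)"
    using finite_edges_between by (intro diff_card_le_card_Diff) simp
  ultimately show ?thesis by (simp add: residual_def)
qed

lemma residual_finite_iff: "finite (residual G L v c w) \<longleftrightarrow> finite (L w)"
  using finite_edges_between by (simp add: residual_def)

text \<open>Each edge to \<open>v\<close> takes at most one color from the list of \<open>w\<close>
  and exactly one from its degree.\<close>

lemma large_lists_residual:
  assumes "finite W" "large_lists G W L" "v \<in> W"
  shows "large_lists G (W - {v}) (residual G L v c)"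
  unfolding large_lists_def
proof
  fix w assume w: "w \<in> W - {v}"
  show "infinite (residual G L v c w) \<or> deg_in G (W - {v}) w \<le> card (residual G L v c w)"
    using residual_card[of L w v c] deg_in_remove[OF assms(1,3), of w] w assms(2) residual_finite_iff[of L v c w]
    by (auto simp: large_lists_def)
qed

lemma colorable_on_residual:
  assumes "c \<in> L v" "colorable_on G (W - {v}) (residual G L v c)"
  shows "colorable_on G W L"
proof -
  obtain \<phi> where \<phi>: "proper_on G (W - {v}) \<phi>" "\<And>w. w \<in> W - {v} \<Longrightarrow> \<phi> w \<in> residual G L v c w"
    using assms(2) by (auto simp: colorable_on_def)
  have nv: "\<phi> w \<noteq> sign G e * c" if "w \<in> W - {v}" "e \<in> edges_between G v w" for w e
    using \<phi>(2)[OF that(1)] that(2) by (auto simp: residual_def)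
  have "proper_on G W (\<phi>(v := c))"
    unfolding proper_on_def
  proof (intro ballI)
    fix x y e assume x: "x \<in> W" and y: "y \<in> W" and e: "e \<in> edges_between G x y"
    then have ne: "x \<noteq> y" and eG: "e \<in> edges G"
      using edges_between_refl edges_betweenD by (blast, blast)
    consider "x = v" "y \<noteq> v" | "y = v" "x \<noteq> v" | "x \<noteq> v" "y \<noteq> v" using ne by blast
    then show "(\<phi>(v := c)) x \<noteq> sign G e * (\<phi>(v := c)) y"
    proof cases
      case 1
      then show ?thesis using nv[of y e] e y sign_mult_self[OF eG, of "\<phi> y"] by auto
    next
      case 2
      then show ?thesis using nv[of x e] e x edges_between_commute[of G x v] by auto
    next
      case 3
      then show ?thesis using \<phi>(1) x y e by (auto simp: proper_on_def)
    qed
  qed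
  moreover have "\<forall>w\<in>W. (\<phi>(v := c)) w \<in> L w"
    using \<phi>(2) assms(1) by (auto simp: residual_def)
  ultimately show ?thesis unfolding colorable_on_def by blast
qed

lemma large_lists_nonempty:
  assumes "finite W" "conn G W" "large_lists G W L" "v \<in> W" "W \<noteq> {v}"
  shows "L v \<noteq> {}"
  using deg_in_pos[OF assms(1,2,4,5)] assms(3,4) by (auto simp: large_lists_def)

text \<open>Greedy coloring that ends at \<open>x\<close>. A removable vertex other than
  \<open>x\<close> still has an uncolored neighbor, hence positive degree and a nonempty list.
  Coloring it lowers the list of \<open>x\<close> by no more than the degree of \<open>x\<close>, so
  the slack survives until \<open>x\<close> is alone.\<close>

lemma colorable_with_slack:
  assumes "finite W" "conn G W" "large_lists G W L" "x \<in> W"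
    and "infinite (L x) \<or> deg_in G W x < card (L x)"
  shows "colorable_on G W L"
  using assms
proof (induction "card W" arbitrary: W L rule: less_induct)
  case less
  show ?case
  proof (cases "W = {x}")
    case True
    obtain c where "c \<in> L x" using less.prems(5) by fastforce
    then have "proper_on G W (\<lambda>_. c)" "\<forall>v\<in>W. c \<in> L v"
      using True edges_between_refl by (auto simp: proper_on_def)
    then show ?thesis unfolding colorable_on_def by blast
  next
    case False
    obtain v where v: "v \<in> W - {x}" "conn G (W - {v})"
      by (rule exists_removable_vertex[OF less.prems(1,2), of "{x}"])
        (use False less.prems(4) conn_singleton[of G x] in auto)
    obtain c where c: "c \<in> L v"
      using large_lists_nonempty[OF less.prems(1,2,3), of v] v less.prems(4) by blast
    have "colorable_on G (W - {v}) (residual G L v c)"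
    proof (rule less.hyps)
      show "card (W - {v}) < card W" using v less.prems(1) by (meson DiffD1 card_Diff1_less)
      show "large_lists G (W - {v}) (residual G L v c)"
        using large_lists_residual less.prems v by blast
      show "infinite (residual G L v c x) \<or> deg_in G (W - {v}) x < card (residual G L v c x)"
        using residual_card[of L x v c] deg_in_remove[OF less.prems(1), of v x] less.prems(5) v
          residual_finite_iff[of L v c x]
        by auto
    qed (use less.prems v in auto)
    then show ?thesis using colorable_on_residual c by blast
  qed
qed

section \<open>Tight lists and forced colors\<close>

lemma criticalD:
  assumes "critical G W L"
  shows "finite W" "W \<subseteq> verts G" "W \<noteq> {}" "conn G W" "large_lists G W L" "\<not> colorable_on G W L"
  using assms finite_verts finite_subset by (auto simp: critical_def)

text \<open>An infinite list, or one larger than the degree, would be slack and allow a greedy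
  coloring. On the full vertex set this is part (a).\<close>

lemma critical_card:
  assumes "critical G W L" "v \<in> W"
  shows "finite (L v)" "card (L v) = deg_in G W v"
  using colorable_with_slack[of W L v] criticalD[OF assms(1)] assms(2)
  by (auto simp: large_lists_def not_less le_antisym)

lemma critical_residual:
  assumes "critical G W L" "v \<in> W" "W \<noteq> {v}" "conn G (W - {v})" "c \<in> L v"
  shows "critical G (W - {v}) (residual G L v c)"
  unfolding critical_def
  using assms criticalD[OF assms(1)] large_lists_residual[of W L v c] colorable_on_residual[of c L v W] by auto

text \<open>The vertices outside \<open>W0\<close> are colored and deleted one at a time, keeping
  the rest connected. The lists obtained depend on the colors chosen, hence the existential
  quantifier.\<close>

lemma critical_hereditary:
  assumes "critical G W L" "W0 \<subseteq> W" "W0 \<noteq> {}" "conn G W0"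
  shows "\<exists>L'. critical G W0 L'"
  using assms
proof (induction "card W" arbitrary: W L rule: less_induct)
  case less
  note D = criticalD[OF less.prems(1)]
  show ?case
  proof (cases "W0 = W")
    case True
    then show ?thesis using less.prems by blast
  next
    case False
    obtain v where v: "v \<in> W - W0" "conn G (W - {v})"
      using exists_removable_vertex[OF D(1,4) less.prems(2) False less.prems(3,4)] by blast
    have ne: "W \<noteq> {v}" using v less.prems by blast
    obtain c where c: "c \<in> L v" using large_lists_nonempty[OF D(1,4,5) _ ne] v by blast
    have "critical G (W - {v}) (residual G L v c)"
      using critical_residual[OF less.prems(1) _ ne v(2) c] v by blast
    moreover have "card (W - {v}) < card W" using v D(1) by (meson DiffD1 card_Diff1_less)
    ultimately show ?thesis using less.hyps[of "W - {v}"] less.prems v by blast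
  qed
qed

text \<open>Lists are tight both before and after \<open>v\<close> receives \<open>c\<close>. The
  list of \<open>w\<close> must therefore shrink by exactly the number of edges to \<open>v\<close>,
  which leaves no room for two edges forbidding the same color or for a forbidden color outside the
  list.\<close>

lemma critical_forced_colors:
  assumes "critical G W L" "v \<in> W" "conn G (W - {v})" "c \<in> L v" "w \<in> W" "w \<noteq> v"
  shows "(\<lambda>e. sign G e * c) ` edges_between G v w \<subseteq> L w"
    and "inj_on (\<lambda>e. sign G e * c) (edges_between G v w)"
proof -
  let ?F = "edges_between G v w" and ?I = "(\<lambda>e. sign G e * c) ` edges_between G v w"
  have cr: "critical G (W - {v}) (residual G L v c)"
    using critical_residual assms by blast
  have "card (L w - ?I) = deg_in G (W - {v}) w"
    using critical_card(2)[OF cr, of w] assms(5,6) by (simp add: residual_def)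
  moreover have fin: "finite (L w)" and "card (L w) = deg_in G W w"
    using critical_card[OF assms(1,5)] by auto
  ultimately have *: "card (L w) = card ?F + card (L w - ?I)"
    using deg_in_remove[OF criticalD(1)[OF assms(1)] assms(2), of w] mult_commute[of G w v]
    by (simp add: mult_def)
  have "card (L w) = card (L w \<inter> ?I) + card (L w - ?I)"
    by (rule card_Int_Diff[OF fin])
  then have "card (L w \<inter> ?I) = card ?F" using * by simp
  moreover have "card (L w \<inter> ?I) \<le> card ?I" by (rule card_mono) (use finite_edges_between in auto)
  moreover have "card ?I \<le> card ?F" by (rule card_image_le[OF finite_edges_between])
  ultimately have eq: "card ?I = card ?F" "card (L w \<inter> ?I) = card ?I" by auto
  show "inj_on (\<lambda>e. sign G e * c) ?F" using eq_card_imp_inj_on[OF finite_edges_between eq(1)] .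
  have "L w \<inter> ?I = ?I" by (rule card_subset_eq) (use eq finite_edges_between in auto)
  then show "?I \<subseteq> L w" by blast
qed

lemma critical_lists_subset:
  assumes "critical G W L" "v \<in> W" "w \<in> W" "conn G (W - {v})" "e \<in> edges_between G v w"
  shows "L v \<subseteq> scale_colors (sign G e) (L w)"
proof
  fix c assume c: "c \<in> L v"
  have "w \<noteq> v" using assms(5) edges_between_refl by blast
  then have "sign G e * c \<in> L w"
    using critical_forced_colors(1)[OF assms(1,2,4) c assms(3)] assms(5) by blast
  then show "c \<in> scale_colors (sign G e) (L w)"
    using sign_mult_self[of e c] edges_betweenD[OF assms(5)] unfolding scale_colors_def by (metis image_eqI)
qed

lemma scale_colors_involution:
  "e \<in> edges G \<Longrightarrow> scale_colors (sign G e) (scale_colors (sign G e) C) = C"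
  by (simp add: scale_colors_def image_image sign_mult_self)

text \<open>Coloring \<open>v\<close> first and coloring \<open>w\<close> first give the two
  inclusions, since scaling by a sign is an involution.\<close>

lemma critical_lists_eq:
  assumes "critical G W L" "v \<in> W" "w \<in> W" "conn G (W - {v})" "conn G (W - {w})"
    and e: "e \<in> edges_between G v w"
  shows "L v = scale_colors (sign G e) (L w)"
proof
  have "L w \<subseteq> scale_colors (sign G e) (L v)"
    using critical_lists_subset[OF assms(1,3,2,5)] e edges_between_commute[of G v w] by simp
  then have "scale_colors (sign G e) (L w) \<subseteq> scale_colors (sign G e) (scale_colors (sign G e) (L v))"
    by (auto simp: scale_colors_def)
  then show "scale_colors (sign G e) (L w) \<subseteq> L v"
    using scale_colors_involution[of e "L v"] edges_betweenD[OF e] by simp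
qed (rule critical_lists_subset[OF assms(1-4) e])

text \<open>Removability is asked of the two ends only. In \<open>critical_exists_dominating\<close>
  the set \<open>W \<union> P\<close> is known to stay connected just when a vertex of
  \<open>W\<close> is removed.\<close>

lemma critical_deg_eq:
  assumes "critical G W L" "v \<in> W" "w \<in> W" "conn G (W - {v})" "conn G (W - {w})" "adjacent G v w"
  shows "deg_in G W v = deg_in G W w"
proof -
  obtain e where e: "e \<in> edges_between G v w" using assms(6) by (auto simp: adjacent_def)
  have "card (scale_colors (sign G e) (L w)) = card (L w)"
    unfolding scale_colors_def using sign_values[of e] edges_betweenD[OF e]
    by (intro card_image) (auto simp: inj_on_def)
  then show ?thesis
    using critical_lists_eq[OF assms(1-5) e] critical_card(2)[OF assms(1)] assms(2,3) by metis
qed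

text \<open>In the critical set consisting of the two ends alone, a color of \<open>v\<close> is
  sent by the parallel edges to distinct colors at \<open>w\<close>, so their signs differ. This is
  the source of part (b).\<close>

lemma critical_parallel_edges:
  assumes "critical G W L" "v \<in> W" "w \<in> W" "adjacent G v w"
  shows "inj_on (sign G) (edges_between G v w)"
proof -
  have ne: "v \<noteq> w" using assms(4) adjacent_irrefl by blast
  have "conn G (insert w {v})" using conn_insert[OF conn_singleton _ assms(4)] by simp
  then obtain L' where cr: "critical G {v, w} L'"
    using critical_hereditary[OF assms(1), of "{v, w}"] assms by (auto simp: insert_commute)
  obtain c where c: "c \<in> L' v"
    using large_lists_nonempty[of "{v, w}" L' v] criticalD[OF cr] ne by blast
  have "conn G ({v, w} - {v})" using ne conn_singleton by (simp add: insert_Diff_if)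
  then have "inj_on (\<lambda>e. sign G e * c) (edges_between G v w)"
    using critical_forced_colors(2)[OF cr _ _ c, of w] ne by simp
  then show ?thesis by (auto simp: inj_on_def)
qed

lemma edges_between_sign_cases:
  assumes "inj_on (sign G) (edges_between G v w)" "adjacent G v w"
  shows "(\<exists>e. edges_between G v w = {e}) \<or>
    (\<exists>e f. edges_between G v w = {e, f} \<and> sign G e = 1 \<and> sign G f = -1)"
proof -
  let ?F = "edges_between G v w"
  have s: "sign G e = 1 \<or> sign G e = -1" if "e \<in> ?F" for e
    using sign_values edges_betweenD[OF that] by blast
  obtain e where e: "e \<in> ?F" using assms(2) by (auto simp: adjacent_def)
  show ?thesis
  proof (cases "?F = {e}")
    case False
    then obtain f where f: "f \<in> ?F" "f \<noteq> e" using e by blast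
    then have ne: "sign G f \<noteq> sign G e" using assms(1) e by (auto simp: inj_on_def)
    have "?F = {e, f}"
    proof (intro equalityI subsetI)
      fix g assume g: "g \<in> ?F"
      then have "sign G g = sign G e \<or> sign G g = sign G f" using s[of g] s[OF e] s[OF f(1)] ne by auto
      then show "g \<in> {e, f}" using assms(1) g e f by (auto simp: inj_on_def)
    qed (use e f in auto)
    then show ?thesis using s[OF e] s[OF f(1)] ne by (metis insert_commute)
  qed blast
qed

end

text \<open>Without 0, negation pairs the positive colors with the negative ones.\<close>

lemma even_card_symmetric:
  fixes C :: "int set"
  assumes "finite C" "C = scale_colors (-1) C" "0 \<notin> C"
  shows "even (card C)"
proof -
  let ?P = "{c \<in> C. c > 0}" and ?N = "{c \<in> C. c < 0}"
  have m: "- c \<in> C" if "c \<in> C" for c using that assms(2) by (auto simp: scale_colors_def)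
  have "bij_betw uminus ?P ?N"
    by (rule bij_betw_byWitness[of _ uminus]) (use m in auto)
  then have "card ?P = card ?N" by (rule bij_betw_same_card)
  moreover have "C = ?P \<union> ?N" using assms(3) by (auto, metis linorder_neqE)
  then have "card C = card ?P + card ?N"
    using assms(1) by (metis (no_types, lifting) card_Un_disjoint disjoint_iff finite_Un mem_Collect_eq order_less_asym)
  ultimately show ?thesis by simp
qed

section \<open>Blocks are complete or cycles\<close>

text \<open>A cycle of the underlying simple graph: only adjacency is recorded, and parallel edges
  are left to \<open>mult\<close>.\<close>

definition cyclic_list :: "('v, 'e) sgraph \<Rightarrow> 'v list \<Rightarrow> bool" where
  "cyclic_list G vs \<longleftrightarrow> length vs \<ge> 3 \<and> distinct vs \<and> successively (adjacent G) vs \<and>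
     adjacent G (last vs) (hd vs)"

definition chordless :: "('v, 'e) sgraph \<Rightarrow> 'v list \<Rightarrow> bool" where
  "chordless G vs \<longleftrightarrow> (\<forall>i<length vs. \<forall>j<length vs. adjacent G (vs ! i) (vs ! j) \<longrightarrow>
     j = Suc i mod length vs \<or> i = Suc j mod length vs)"

lemma rtranclp_crossing:
  assumes "r\<^sup>*\<^sup>* a b" "a \<in> A" "b \<notin> A"
  shows "\<exists>x y. x \<in> A \<and> y \<notin> A \<and> r x y"
  using assms by (induction rule: rtranclp_induct) blast+

lemma conn_clique:
  assumes "\<And>x y. x \<in> S \<Longrightarrow> y \<in> S \<Longrightarrow> x \<noteq> y \<Longrightarrow> adjacent G x y"
  shows "conn G S"
proof (rule connI)
  fix A assume "A \<subseteq> S" "A \<noteq> {}" "A \<noteq> S"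
  then obtain a b where "a \<in> A" "b \<in> S - A" by blast
  then show "\<exists>a\<in>A. \<exists>b\<in>S - A. adjacent G a b" using assms[of a b] \<open>A \<subseteq> S\<close> by blast
qed

lemma conn_successively:
  assumes "successively (adjacent G) p"
  shows "conn G (set p)"
  using assms
proof (induction p)
  case Nil
  then show ?case by (simp add: conn_empty)
next
  case (Cons x q)
  show ?case
  proof (cases "q = []")
    case True
    then show ?thesis by (simp add: conn_singleton)
  next
    case False
    then have "adjacent G (hd q) x" "conn G (set q)"
      using Cons adjacent_commute[of G x] by (auto simp: successively_Cons)
    then show ?thesis using conn_insert[of G "set q" "hd q" x] False by simp
  qed
qed

lemma exists_path:
  assumes "conn G S" "x \<in> S" "y \<in> S"
  shows "\<exists>p. p \<noteq> [] \<and> hd p = x \<and> last p = y \<and> distinct p \<and> set p \<subseteq> S \<and>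
    successively (adjacent G) p"
proof -
  define path where "path y p \<longleftrightarrow> p \<noteq> [] \<and> hd p = x \<and> last p = y \<and> distinct p \<and> set p \<subseteq> S \<and>
    successively (adjacent G) p" for y p
  define A where "A = {z \<in> S. \<exists>p. path z p}"
  have "path x [x]" using assms by (simp add: path_def)
  then have xA: "x \<in> A" using assms by (auto simp: A_def)
  have "A = S"
  proof (rule ccontr)
    assume ne: "A \<noteq> S"
    obtain a b where ab: "a \<in> A" "b \<in> S" "b \<notin> A" "adjacent G a b"
      by (rule connE[OF assms(1) _ _ ne]) (use xA in \<open>auto simp: A_def\<close>)
    obtain p where p: "path a p" using ab by (auto simp: A_def)
    show False
    \<comment> \<open>Appending \<open>b\<close> would break distinctness if the path already visits
      \<open>b\<close>; in that case it is cut off at \<open>b\<close>.\<close>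
    proof (cases "b \<in> set p")
      case True
      then obtain ys zs where "p = ys @ b # zs" by (meson split_list)
      then have "path b (ys @ [b])"
        using p by (auto simp: path_def successively_append_iff hd_append split: if_splits)
      then show False using ab by (auto simp: A_def)
    next
      case False
      then have "path b (p @ [b])"
        using p ab by (auto simp: path_def successively_append_iff)
      then show False using ab by (auto simp: A_def)
    qed
  qed
  then show ?thesis using assms(3) by (auto simp: A_def path_def)
qed

lemma cyclic_list_adjacent:
  assumes "cyclic_list G vs" "i < length vs"
  shows "adjacent G (vs ! i) (vs ! (Suc i mod length vs))"
proof (cases "Suc i = length vs")
  case True
  then have "vs \<noteq> []" "i = length vs - 1" by auto
  then have "vs ! i = last vs" "vs ! 0 = hd vs" by (auto simp: last_conv_nth hd_conv_nth)
  then show ?thesis using assms True by (auto simp: cyclic_list_def)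
next
  case False
  then have "Suc i < length vs" using assms by simp
  then show ?thesis using assms by (auto simp: cyclic_list_def successively_conv_nth)
qed

text \<open>Removing \<open>v\<close> leaves the two stretches before and after it, which the
  closing edge of the cycle joins.\<close>

lemma cyclic_list_two_conn:
  assumes "cyclic_list G vs"
  shows "two_conn G (set vs)"
  unfolding two_conn_def
proof (intro conjI ballI)
  show "set vs \<noteq> {}" using assms by (auto simp: cyclic_list_def)
  show "conn G (set vs)" using assms conn_successively by (auto simp: cyclic_list_def)
  fix v assume "v \<in> set vs"
  then obtain ys zs where vs: "vs = ys @ v # zs" by (meson split_list)
  have d: "distinct vs" "successively (adjacent G) vs" using assms by (auto simp: cyclic_list_def)
  have c: "conn G (set ys)" "conn G (set zs)"
    using d(2) by (auto simp: vs successively_append_iff successively_Cons intro: conn_successively)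
  have eq: "set vs - {v} = set zs \<union> set ys" using d(1) by (auto simp: vs)
  show "conn G (set vs - {v})"
  proof (cases "ys = [] \<or> zs = []")
    case True
    then show ?thesis unfolding eq using c by auto
  next
    case False
    then have "adjacent G (last zs) (hd ys)" using assms by (auto simp: cyclic_list_def vs)
    then show ?thesis unfolding eq using conn_Un[OF c(2,1), of "last zs" "hd ys"] False by simp
  qed
qed

text \<open>Connectivity of \<open>V\<close> gives \<open>x\<close> a neighbor \<open>y\<close>,
  connectivity of \<open>V - {y}\<close> a second neighbor \<open>z\<close>. A path from
  \<open>y\<close> to \<open>z\<close> in \<open>V - {x}\<close> closes up through
  \<open>x\<close>.\<close>

lemma exists_cyclic_list:
  assumes "two_conn G V" "finite V" "card V \<ge> 3"
  shows "\<exists>vs. cyclic_list G vs \<and> set vs \<subseteq> V"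
proof -
  have rm: "conn G (V - {v})" if "v \<in> V" for v using assms that by (auto simp: two_conn_def)
  have big: "\<not> V \<subseteq> {a, b}" for a b
  proof
    assume "V \<subseteq> {a, b}"
    then have "card V \<le> card {a, b}" by (intro card_mono) auto
    also have "\<dots> \<le> 2" by (simp add: card_insert_if)
    finally show False using assms(3) by simp
  qed
  obtain x where x: "x \<in> V" using big by blast
  obtain y where y: "y \<in> V" "y \<noteq> x" "adjacent G x y"
    using conn_neighbor[of G V x] assms(1) x big[of x x] by (auto simp: two_conn_def)
  have "V - {y} \<noteq> {x}" using big[of x y] by blast
  then obtain z where z: "z \<in> V - {y}" "z \<noteq> x" "adjacent G x z"
    using conn_neighbor[OF rm[OF y(1)], of x] x y by blast
  obtain p where p: "p \<noteq> []" "hd p = y" "last p = z" "distinct p" "set p \<subseteq> V - {x}"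
      "successively (adjacent G) p"
    using exists_path[OF rm[OF x], of y z] y z by blast
  have "length p \<ge> 2" using p z by (cases p; cases "tl p") auto
  then have "cyclic_list G (x # p)"
    using p y z adjacent_commute[of G x z] by (auto simp: cyclic_list_def successively_Cons)
  then show ?thesis using p x by (intro exI[of _ "x # p"]) auto
qed

context signed_graph
begin

section \<open>Components and separating vertices in terms of cuts\<close>

lemma reachable_conn_iff:
  "(\<forall>v\<in>verts G. \<forall>w\<in>verts G. (v, w) \<in> reachable G) \<longleftrightarrow> conn G (verts G)" (is "?l \<longleftrightarrow> ?r")
proof
  assume l: ?l
  show ?r
  proof (rule connI)
    fix A assume A: "A \<subseteq> verts G" "A \<noteq> {}" "A \<noteq> verts G"
    then obtain a b where ab: "a \<in> A" "b \<in> verts G" "b \<notin> A" by blast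
    then have "(adjacent G)\<^sup>*\<^sup>* a b" using l A by (auto simp: reachable_def)
    then obtain x y where "x \<in> A" "y \<notin> A" "adjacent G x y"
      using rtranclp_crossing[of "adjacent G" a b A] ab by blast
    then show "\<exists>a\<in>A. \<exists>b\<in>verts G - A. adjacent G a b" using adjacent_verts[of x y] by blast
  qed
next
  assume r: ?r
  show ?l
  proof (intro ballI)
    fix v w assume v: "v \<in> verts G" and w: "w \<in> verts G"
    define A where "A = {u \<in> verts G. (adjacent G)\<^sup>*\<^sup>* v u}"
    have "A = verts G"
    proof (rule ccontr)
      assume ne: "A \<noteq> verts G"
      obtain a b where ab: "a \<in> A" "b \<in> verts G" "b \<notin> A" "adjacent G a b"
        by (rule connE[OF r _ _ ne]) (use v in \<open>auto simp: A_def\<close>)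
      then show False by (auto simp: A_def dest: rtranclp.rtrancl_into_rtrancl)
    qed
    then show "(v, w) \<in> reachable G" using v w by (auto simp: A_def reachable_def)
  qed
qed

lemma connected_iff_conn: "connected G \<longleftrightarrow> verts G \<noteq> {} \<and> conn G (verts G)"
  using reachable_conn_iff by (auto simp: connected_def)

lemma equiv_reachable: "equiv (verts G) (reachable G)"
proof (rule equivI)
  show "reachable G \<subseteq> verts G \<times> verts G" by (auto simp: reachable_def)
  show "refl_on (verts G) (reachable G)" by (auto simp: refl_on_def reachable_def)
  have "symp (adjacent G)" by (rule sympI) (metis adjacent_commute)
  then have "symp (adjacent G)\<^sup>*\<^sup>*" by (rule symp_rtranclp)
  then show "sym (reachable G)" by (auto simp: sym_def reachable_def symp_def)
  show "trans (reachable G)" by (auto simp: trans_def reachable_def)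
qed

lemma finite_components: "finite (components G)"
  unfolding components_def quotient_def using finite_verts by blast

text \<open>The inequality includes the graph without vertices, which arises when the only vertex is
  deleted: it has no components and its vertex set counts as connected.\<close>

lemma card_components_le_one_iff: "card (components G) \<le> 1 \<longleftrightarrow> conn G (verts G)"
proof
  assume l: "card (components G) \<le> 1"
  have "(v, w) \<in> reachable G" if "v \<in> verts G" "w \<in> verts G" for v w
  proof -
    have "reachable G `` {v} = reachable G `` {w}"
      using l finite_components that
      by (metis card_le_Suc0_iff_eq One_nat_def components_def quotientI)
    then show ?thesis using eq_equiv_class_iff[OF equiv_reachable that] by simp
  qed
  then show "conn G (verts G)" using reachable_conn_iff by blast
next
  assume "conn G (verts G)"
  then have "reachable G `` {v} = verts G" if "v \<in> verts G" for v
    using reachable_conn_iff that by (auto simp: reachable_def)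
  then have "components G \<subseteq> {verts G}" by (auto simp: components_def quotient_def)
  then have "card (components G) \<le> card {verts G}" by (intro card_mono) auto
  then show "card (components G) \<le> 1" by simp
qed

lemma signed_graph_delete_vertex: "signed_graph (delete_vertex G v)"
  using finite_verts finite_edges ends_verts card_ends sign_values
  by unfold_locales (auto simp: delete_vertex_def)

lemma adjacent_delete_vertex:
  "a \<noteq> v \<Longrightarrow> b \<noteq> v \<Longrightarrow> adjacent (delete_vertex G v) a b \<longleftrightarrow> adjacent G a b"
  by (auto simp: adjacent_def edges_between_def delete_vertex_def)

lemma conn_delete_vertex: "conn (delete_vertex G v) (verts G - {v}) \<longleftrightarrow> conn G (verts G - {v})"
  by (rule iffI; erule conn_mono_edges) (auto simp: adjacent_delete_vertex)

lemma is_block_iff_two_conn: "is_block G \<longleftrightarrow> two_conn G (verts G)"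
proof (cases "connected G")
  case True
  then have V: "verts G \<noteq> {}" "conn G (verts G)" by (auto simp: connected_iff_conn)
  then have "components G \<noteq> {}" by (auto simp: components_def quotient_def)
  then have "card (components G) = 1"
    using card_components_le_one_iff V finite_components by (simp add: le_antisym Suc_leI card_gt_0_iff)
  moreover have "verts (delete_vertex G v) = verts G - {v}" for v by (simp add: delete_vertex_def)
  ultimately have "separating_vertex G v \<longleftrightarrow> v \<in> verts G \<and> \<not> conn G (verts G - {v})" for v
    using signed_graph.card_components_le_one_iff[OF signed_graph_delete_vertex[of v]]
      conn_delete_vertex[of v]
    by (auto simp: separating_vertex_def)
  then show ?thesis using True V by (auto simp: is_block_def two_conn_def)
next
  case False
  then show ?thesis by (auto simp: is_block_def two_conn_def connected_iff_conn)
qed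

section \<open>Dominating vertices and the dichotomy between complete graphs and cycles\<close>

lemma critical_exists_dominating:
  assumes cr: "critical G V L" and V2: "two_conn G V"
    and W: "W \<subseteq> V" "W \<noteq> V" "two_conn G W" "card W \<ge> 3"
  shows "\<exists>p\<in>V - W. \<forall>w\<in>W. adjacent G w p"
proof -
  \<comment> \<open>\<open>N P\<close> is the set of attachments of \<open>P\<close> in
    \<open>W\<close>.\<close>
  define N where "N P = {w \<in> W. \<exists>p\<in>P. adjacent G w p}" for P
  have finV: "finite V" using criticalD[OF cr] by simp
  then have finW: "finite W" using W finite_subset by blast
  then have finN: "finite (N P)" for P by (simp add: N_def)
  define F where "F = {P. P \<subseteq> V - W \<and> P \<noteq> {} \<and> conn G P}"
  have finF: "finite F" by (rule finite_subset[of _ "Pow V"]) (use finV in \<open>auto simp: F_def\<close>)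
  \<comment> \<open>A maximal connected \<open>P\<close> outside \<open>W\<close> can only be left
    through \<open>W\<close>. Leaving it inside \<open>V\<close> yields an attachment
    \<open>w0\<close>, and leaving it inside \<open>V - {w0}\<close> yields a second one.\<close>
  have "\<exists>P\<in>F. card (N P) \<ge> 2"
  proof -
    obtain x where "x \<in> V - W" using W by blast
    then have "{x} \<in> F" using conn_singleton[of G x] by (simp add: F_def)
    then obtain P where PF: "P \<in> F" and max: "\<And>Q. Q \<in> F \<Longrightarrow> P \<subseteq> Q \<Longrightarrow> P = Q"
      using finite_has_maximal[OF finF] by auto
    have P: "P \<subseteq> V - W" "P \<noteq> {}" "conn G P" using PF by (auto simp: F_def)
    have attach: "\<exists>b\<in>T. b \<in> N P" if T: "conn G T" "P \<subseteq> T" "T \<subseteq> V" "P \<noteq> T" for T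
    proof -
      obtain a b where ab: "a \<in> P" "b \<in> T" "b \<notin> P" "adjacent G a b"
        using connE[OF T(1,2) P(2) T(4)] by blast
      have "b \<in> W"
      proof (rule ccontr)
        assume "b \<notin> W"
        then have "insert b P \<in> F" using P ab T conn_insert[OF P(3) ab(1,4)] by (auto simp: F_def)
        then show False using max[of "insert b P"] ab by blast
      qed
      then show ?thesis using ab adjacent_commute[of G a b] by (auto simp: N_def)
    qed
    obtain w0 where w0: "w0 \<in> N P"
      using attach[of V] V2 P W by (auto simp: two_conn_def)
    have w0W: "w0 \<in> W" using w0 by (simp add: N_def)
    have "W \<noteq> {w0}" using W(4) by auto
    then have "P \<noteq> V - {w0}" using w0W W P by blast
    then obtain w1 where w1: "w1 \<in> V - {w0}" "w1 \<in> N P"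
      using attach[of "V - {w0}"] V2 P W w0W by (auto simp: two_conn_def)
    have "card {w0, w1} \<le> card (N P)" using w0 w1 finN by (intro card_mono) auto
    moreover have "card {w0, w1} = 2" using w1 by auto
    ultimately have "2 \<le> card (N P)" by simp
    then show ?thesis using PF by blast
  qed
  then have "{P \<in> F. card (N P) \<ge> 2} \<noteq> {}" by blast
  then obtain P where P2: "P \<in> F" "card (N P) \<ge> 2"
    and min: "\<And>Q. Q \<in> F \<Longrightarrow> card (N Q) \<ge> 2 \<Longrightarrow> Q \<subseteq> P \<Longrightarrow> P = Q"
    using finite_has_minimal[of "{P \<in> F. card (N P) \<ge> 2}"] finF by auto
  have P: "P \<subseteq> V - W" "P \<noteq> {}" "conn G P" using P2 by (auto simp: F_def)
  have finP: "finite P" using P finV finite_subset by blast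
  \<comment> \<open>A second attachment keeps \<open>P\<close> joined to \<open>W\<close> when any
    one vertex of \<open>W\<close> is removed.\<close>
  have other: "\<exists>w'\<in>N P. w' \<noteq> w" for w
  proof (rule ccontr)
    assume "\<not> (\<exists>w'\<in>N P. w' \<noteq> w)"
    then have "card (N P) \<le> card {w}" by (intro card_mono) auto
    then show False using P2 by simp
  qed
  have joined: "conn G (S \<union> P)" if S: "conn G S" "w' \<in> N P" "w' \<in> S" for S w'
    using conn_Un[OF S(1) P(3) S(3)] S(2) by (auto simp: N_def)
  have NW: "N P \<subseteq> W" by (auto simp: N_def)
  obtain w where "w \<in> N P" using other by blast
  then have "conn G (W \<union> P)" using joined[of W w] W(3) NW by (auto simp: two_conn_def)
  then obtain L1 where L1: "critical G (W \<union> P) L1"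
    using critical_hereditary[OF cr, of "W \<union> P"] W P by blast
  obtain L2 where L2: "critical G W L2"
    using critical_hereditary[OF cr W(1)] W(3) by (auto simp: two_conn_def)
  have rmW: "conn G (W - {w})" if "w \<in> W" for w using W(3) that by (auto simp: two_conn_def)
  have rmU: "conn G (W \<union> P - {w})" if "w \<in> W" for w
  proof -
    obtain w' where "w' \<in> N P" "w' \<noteq> w" using other by blast
    then have "conn G ((W - {w}) \<union> P)" using joined[OF rmW[OF that], of w'] NW by auto
    moreover have "W \<union> P - {w} = (W - {w}) \<union> P" using that P by blast
    ultimately show ?thesis by simp
  qed
  have deg: "deg_in G (W \<union> P) x = deg_in G W x + deg_in G P x" for x
    unfolding deg_in_def by (rule sum.union_disjoint) (use finW finP P in auto)
  have zero: "deg_in G P x = 0 \<longleftrightarrow> x \<notin> N P" if "x \<in> W" for x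
    using finP that by (auto simp: deg_in_def N_def adjacent_iff_mult)
  \<comment> \<open>Otherwise some edge of \<open>W\<close> joins an attachment \<open>a\<close> to
    a non-attachment \<open>b\<close>. Their degrees agree in \<open>W\<close> and in
    \<open>W \<union> P\<close>, hence also into \<open>P\<close>; but \<open>a\<close> has
    neighbors in \<open>P\<close> and \<open>b\<close> has none.\<close>
  have all: "N P = W"
  proof (rule ccontr)
    assume ne: "N P \<noteq> W"
    obtain a b where ab: "a \<in> N P" "b \<in> W" "b \<notin> N P" "adjacent G a b"
      by (rule connE[OF _ NW _ ne]) (use other W(3) in \<open>auto simp: two_conn_def\<close>)
    have aW: "a \<in> W" using ab by (simp add: N_def)
    have "deg_in G (W \<union> P) a = deg_in G (W \<union> P) b"
      using critical_deg_eq[OF L1 _ _ rmU rmU ab(4)] aW ab(2) by blast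
    moreover have "deg_in G W a = deg_in G W b"
      using critical_deg_eq[OF L2 aW ab(2) rmW[OF aW] rmW[OF ab(2)] ab(4)] .
    ultimately show False using deg zero[of a] zero[of b] aW ab by simp
  qed
  obtain p where p: "p \<in> P" using P by blast
  \<comment> \<open>Otherwise a removable vertex \<open>a\<close> splits \<open>P\<close> into the
    smaller connected sets \<open>{a}\<close> and \<open>P - {a}\<close>. By minimality each has at
    most one attachment, too few for the at least three vertices of \<open>W\<close>.\<close>
  have "P = {p}"
  proof (rule ccontr)
    assume ne: "P \<noteq> {p}"
    obtain a where a: "a \<in> P - {p}" "conn G (P - {a})"
      by (rule exists_removable_vertex[OF finP P(3), of "{p}"])
        (use p ne conn_singleton[of G p] in auto)
    have "P - {a} \<in> F" using a p P by (auto simp: F_def)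
    then have 1: "card (N (P - {a})) \<le> 1" using min[of "P - {a}"] a by fastforce
    have "{a} \<in> F" using a P conn_singleton[of G a] by (auto simp: F_def)
    then have 2: "card (N {a}) \<le> 1" using min[of "{a}"] a p by fastforce
    have "N P \<subseteq> N (P - {a}) \<union> N {a}" by (auto simp: N_def)
    then have "card (N P) \<le> card (N (P - {a}) \<union> N {a})" using finN by (intro card_mono) auto
    also have "\<dots> \<le> card (N (P - {a})) + card (N {a})" by (rule card_Un_le)
    finally show False using 1 2 all W(4) by simp
  qed
  then have "\<forall>w\<in>W. adjacent G w p" using all by (auto simp: N_def)
  then show ?thesis using p P by blast
qed

text \<open>An edge between positions \<open>i < j\<close> closes the segment from \<open>i\<close>
  to \<open>j\<close> into a cycle. The segment has at least three vertices unless the positions are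
  consecutive, and it is shorter than \<open>vs\<close> unless they are the first and the
  last.\<close>

lemma shortest_cyclic_list_chordless:
  assumes vs: "cyclic_list G vs"
    and min: "\<And>ws. cyclic_list G ws \<Longrightarrow> set ws \<subseteq> set vs \<Longrightarrow> length vs \<le> length ws"
  shows "chordless G vs"
proof -
  let ?n = "length vs"
  have *: "j = Suc i \<or> (i = 0 \<and> Suc j = ?n)"
    if ij: "i < j" "j < ?n" and adj: "adjacent G (vs ! i) (vs ! j)" for i j
  proof (rule ccontr)
    assume neg: "\<not> ?thesis"
    define ws where "ws = drop i (take (Suc j) vs)"
    have len: "length ws = Suc j - i" using ij by (simp add: ws_def)
    have nth: "ws ! k = vs ! (i + k)" if "k < length ws" for k
      using that ij len by (simp add: ws_def)
    have "distinct ws" using vs by (simp add: ws_def cyclic_list_def)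
    moreover have "successively (adjacent G) ws"
      using vs nth len ij by (auto simp: cyclic_list_def successively_conv_nth)
    moreover have "hd ws = vs ! i" "last ws = vs ! j"
      using nth[of 0] nth[of "length ws - 1"] len ij hd_conv_nth[of ws] last_conv_nth[of ws] by fastforce+
    ultimately have "cyclic_list G ws"
      using adj adjacent_commute[of G "vs ! i"] len neg ij by (auto simp: cyclic_list_def)
    moreover have "set ws \<subseteq> set vs" unfolding ws_def by (meson set_drop_subset set_take_subset subset_trans)
    ultimately show False using min[of ws] len neg ij by auto
  qed
  show ?thesis
    unfolding chordless_def
  proof (intro allI impI)
    fix i j assume ij: "i < ?n" "j < ?n" and adj: "adjacent G (vs ! i) (vs ! j)"
    then have "i \<noteq> j" using adjacent_irrefl by auto
    then consider "i < j" | "j < i" by linarith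
    then show "j = Suc i mod ?n \<or> i = Suc j mod ?n"
    proof cases
      case 1
      then show ?thesis using *[of i j] ij adj by auto
    next
      case 2
      then show ?thesis using *[of j i] ij adj adjacent_commute[of G "vs ! i"] by auto
    qed
  qed
qed

lemma critical_complete_or_cycle:
  assumes cr: "critical G V L" and V2: "two_conn G V" and V3: "card V \<ge> 3"
  shows "(\<forall>x\<in>V. \<forall>y\<in>V. x \<noteq> y \<longrightarrow> adjacent G x y) \<or>
    (\<exists>vs. cyclic_list G vs \<and> chordless G vs \<and> set vs = V \<and> length vs \<ge> 4)"
proof -
  have finV: "finite V" using criticalD[OF cr] by simp
  obtain vs where vs: "cyclic_list G vs" "set vs \<subseteq> V"
    and min: "\<And>ws. cyclic_list G ws \<Longrightarrow> set ws \<subseteq> V \<Longrightarrow> length vs \<le> length ws"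
    using exists_cyclic_list[OF V2 finV V3]
      ex_has_least_nat[of "\<lambda>vs. cyclic_list G vs \<and> set vs \<subseteq> V" _ length] by blast
  have d: "distinct vs" "length vs \<ge> 3" using vs by (auto simp: cyclic_list_def)
  show ?thesis
  proof (cases "length vs = 3")
    case True
    then obtain a b c where abc: "vs = [a, b, c]"
      by (metis (no_types, lifting) length_0_conv length_Suc_conv numeral_3_eq_3)
    define clique where "clique K \<longleftrightarrow> (\<forall>x\<in>K. \<forall>y\<in>K. x \<noteq> y \<longrightarrow> adjacent G x y)" for K
    \<comment> \<open>The triangle \<open>vs\<close> belongs to this family, so a maximal member has
      the three vertices that domination requires.\<close>
    define F where "F = {K. K \<subseteq> V \<and> card K \<ge> 3 \<and> clique K}"
    have "finite F" by (rule finite_subset[of _ "Pow V"]) (use finV in \<open>auto simp: F_def\<close>)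
    moreover have "set vs \<in> F"
      using vs d adjacent_commute[of G] distinct_card[OF d(1)]
      by (auto simp: F_def clique_def abc cyclic_list_def)
    ultimately obtain K where "K \<in> F" and max: "\<And>K'. K' \<in> F \<Longrightarrow> K \<subseteq> K' \<Longrightarrow> K = K'"
      using finite_has_maximal[of F] by auto
    then have K: "K \<subseteq> V" "card K \<ge> 3" "clique K" by (auto simp: F_def)
    have finK: "finite K" using K finV finite_subset by blast
    have "K = V"
    proof (rule ccontr)
      assume ne: "K \<noteq> V"
      have "two_conn G K"
        using K(2,3) conn_clique[of K G] conn_clique[of "K - {v}" G for v]
        by (auto simp: two_conn_def clique_def)
      then obtain p where p: "p \<in> V - K" "\<forall>w\<in>K. adjacent G w p"
        using critical_exists_dominating[OF cr V2 K(1) ne _ K(2)] by blast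
      then have "clique (insert p K)"
        using K(3) unfolding clique_def by (metis adjacent_commute insert_iff)
      then have "insert p K \<in> F" using p K finK by (auto simp: F_def)
      then show False using max[of "insert p K"] p by blast
    qed
    then show ?thesis using K(3) by (auto simp: clique_def)
  next
    case False
    then have 4: "length vs \<ge> 4" using d by simp
    have "set vs = V"
    proof (rule ccontr)
      assume ne: "set vs \<noteq> V"
      obtain p where p: "p \<in> V - set vs" "\<forall>w\<in>set vs. adjacent G w p"
        using critical_exists_dominating[OF cr V2 vs(2) ne cyclic_list_two_conn[OF vs(1)]]
          distinct_card[OF d(1)] d(2) by auto
      \<comment> \<open>Together with two consecutive vertices of the cycle, a dominating vertex
        would form a triangle, shorter than the shortest cycle.\<close>
      obtain a b ws where ab: "vs = a # b # ws"
        using 4 by (cases vs; cases "tl vs") auto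
      have "cyclic_list G [p, a, b]"
        using p vs(1) adjacent_commute[of G p a] by (auto simp: ab cyclic_list_def)
      then show False using min[of "[p, a, b]"] 4 p vs(2) by (auto simp: ab)
    qed
    moreover have "chordless G vs"
      using shortest_cyclic_list_chordless[OF vs(1)] min vs(2) by blast
    ultimately show ?thesis using vs 4 by blast
  qed
qed

end

section \<open>Multiplicities and signs\<close>

lemma conn_invariant:
  assumes "conn G V" "x \<in> V" "P x"
    and step: "\<And>a b. a \<in> V \<Longrightarrow> b \<in> V \<Longrightarrow> P a \<Longrightarrow> adjacent G a b \<Longrightarrow> P b"
    and "y \<in> V"
  shows "P y"
proof -
  define A where "A = {v \<in> V. P v}"
  have "A = V"
  proof (rule ccontr)
    assume ne: "A \<noteq> V"
    obtain a b where "a \<in> A" "b \<in> V" "b \<notin> A" "adjacent G a b"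
      by (rule connE[OF assms(1) _ _ ne]) (use assms(2,3) in \<open>auto simp: A_def\<close>)
    then show False using step[of a b] by (auto simp: A_def)
  qed
  then show ?thesis using assms(5) by (auto simp: A_def)
qed

lemma prod_mod_shift:
  fixes g :: "nat \<Rightarrow> int"
  shows "(\<Prod>i<n. g (Suc i mod n)) = (\<Prod>i<n. g i)"
proof (cases n)
  case (Suc m)
  have "(\<Prod>i<m. g (Suc i mod Suc m)) = (\<Prod>i<m. g (Suc i))" by (rule prod.cong) auto
  then show ?thesis unfolding Suc prod.lessThan_Suc by (simp add: prod.lessThan_Suc_shift flip: prod.lessThan_Suc)
qed simp

lemma prod_unit:
  fixes g :: "'a \<Rightarrow> int"
  assumes "\<And>i. i \<in> I \<Longrightarrow> g i = 1 \<or> g i = -1"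
  shows "prod g I = 1 \<or> prod g I = -1"
  using assms
proof (induction I rule: infinite_finite_induct)
  case (insert x F)
  then have "g x = 1 \<or> g x = -1" "prod g F = 1 \<or> prod g F = -1" by blast+
  then show ?case using insert.hyps by auto
qed auto

section \<open>Sign products and balance\<close>

lemma cycle_sign_product:
  assumes "is_cycle_in G vs es"
  shows "(\<Prod>e\<in>set es. sign G e) = (\<Prod>i<length vs. sign G (es ! i))"
proof -
  have "bij_betw ((!) es) {..<length vs} (set es)"
    using assms by (intro bij_betw_nth) (auto simp: is_cycle_in_def)
  then show ?thesis by (simp add: prod.reindex_bij_betw)
qed

text \<open>Around a cycle every vertex contributes its potential \<open>s\<close> twice, so the
  sign product is the square of a unit.\<close>

lemma balanced_if_potential:
  fixes s :: "'v \<Rightarrow> int"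
  assumes "\<And>e v w. e \<in> edges G \<Longrightarrow> ends G e = {v, w} \<Longrightarrow> sign G e = s v * s w"
    and unit: "\<And>v. s v = 1 \<or> s v = -1"
  shows "balanced G"
  unfolding balanced_def
proof (intro allI impI)
  fix vs es assume c: "is_cycle_in G vs es"
  let ?n = "length vs" and ?p = "\<Prod>i<length vs. s (vs ! i)"
  have "(\<Prod>e\<in>set es. sign G e) = (\<Prod>i<?n. s (vs ! i) * s (vs ! (Suc i mod ?n)))"
    unfolding cycle_sign_product[OF c]
    by (rule prod.cong) (use c assms(1) in \<open>auto simp: is_cycle_in_def subset_iff\<close>)
  also have "\<dots> = ?p * ?p"
    unfolding prod.distrib using prod_mod_shift[of "\<lambda>i. s (vs ! i)" ?n] by simp
  also have "\<dots> = 1" using prod_unit[of "{..<?n}" "\<lambda>i. s (vs ! i)"] unit by auto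
  finally show "(\<Prod>e\<in>set es. sign G e) = 1" .
qed

text \<open>Two different positions with the same pair of ends would each be the successor of the
  other, which only happens on a cycle of length two.\<close>

lemma cyclic_edge_determines_index:
  assumes "distinct vs" "length vs \<ge> 3" "i < length vs" "j < length vs"
    and "{vs ! i, vs ! (Suc i mod length vs)} = {vs ! j, vs ! (Suc j mod length vs)}"
  shows "i = j"
proof (rule ccontr)
  assume "i \<noteq> j"
  let ?n = "length vs"
  have lt: "Suc i mod ?n < ?n" "Suc j mod ?n < ?n" using assms(2) by (auto intro: mod_less_divisor)
  have "vs ! i \<noteq> vs ! j" using \<open>i \<noteq> j\<close> nth_eq_iff_index_eq[OF assms(1,3,4)] by simp
  then have "vs ! i = vs ! (Suc j mod ?n)" "vs ! j = vs ! (Suc i mod ?n)"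
    using assms(5) unfolding doubleton_eq_iff by metis+
  then have "i = Suc j mod ?n" "j = Suc i mod ?n"
    using nth_eq_iff_index_eq[OF assms(1,3) lt(2)] nth_eq_iff_index_eq[OF assms(1,4) lt(1)]
    by blast+
  moreover have "Suc k mod ?n = (if Suc k = ?n then 0 else Suc k)" if "k < ?n" for k
    using that by simp
  ultimately have "(Suc j = ?n \<and> i = 0) \<or> i = Suc j" "(Suc i = ?n \<and> j = 0) \<or> j = Suc i"
    using assms(3,4) by metis+
  then show False using assms(2) by (elim disjE conjE) linarith+
qed

context signed_graph
begin

lemma chordless_triangle: "chordless G [x, y, z]"
  unfolding chordless_def
proof (intro allI impI)
  fix i j assume ij: "i < length [x, y, z]" "j < length [x, y, z]"
    and adj: "adjacent G ([x, y, z] ! i) ([x, y, z] ! j)"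
  have "i \<noteq> j" using adj adjacent_irrefl by metis
  moreover have "i = 0 \<or> i = 1 \<or> i = 2" "j = 0 \<or> j = 1 \<or> j = 2" using ij by auto
  ultimately show "j = Suc i mod length [x, y, z] \<or> i = Suc j mod length [x, y, z]"
    by (elim disjE) simp_all
qed

section \<open>Multiplicities in cliques and cycles\<close>

lemma critical_invariant_deg:
  assumes "critical G W L" "two_conn G W" "v \<in> W" "w \<in> W"
  shows "deg_in G W w = deg_in G W v"
proof (rule conn_invariant[of G W v "\<lambda>w. deg_in G W w = deg_in G W v" w])
  fix a b assume "a \<in> W" "b \<in> W" "deg_in G W a = deg_in G W v" "adjacent G a b"
  then show "deg_in G W b = deg_in G W v"
    using critical_deg_eq[OF assms(1), of a b] assms(2) by (auto simp: two_conn_def)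
qed (use assms in \<open>auto simp: two_conn_def\<close>)

lemma critical_mult_cases:
  assumes "critical G W L" "v \<in> W" "w \<in> W" "adjacent G v w"
  shows "(mult G v w = 1 \<and> (\<exists>e. edges_between G v w = {e})) \<or>
    (mult G v w = 2 \<and> (\<exists>e f. edges_between G v w = {e, f} \<and> sign G e = 1 \<and> sign G f = -1))"
proof -
  consider e where "edges_between G v w = {e}"
    | e f where "edges_between G v w = {e, f}" "sign G e = 1" "sign G f = -1"
    using edges_between_sign_cases[OF critical_parallel_edges[OF assms] assms(4)] by blast
  then show ?thesis
  proof cases
    case 1
    then show ?thesis by (simp add: mult_def)
  next
    case 2
    then have "e \<noteq> f" by auto
    then show ?thesis using 2 by (auto simp: mult_def)
  qed
qed

lemma critical_double_edge:
  assumes "critical G W L" "v \<in> W" "w \<in> W" "mult G v w = 2"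
  obtains e f where "edges_between G v w = {e, f}" "sign G e = 1" "sign G f = -1"
  using critical_mult_cases[OF assms(1-3)] assms(4) adjacent_iff_mult[of v w] by auto

text \<open>The positive edge identifies the two lists and the negative edge then makes them
  symmetric. Both edges would forbid the same color if 0 were used, contrary to the distinctness of
  forbidden colors.\<close>

lemma critical_double_edge_lists:
  assumes "critical G W L" "two_conn G W" "v \<in> W" "w \<in> W" "mult G v w = 2"
  shows "L v = L w" "L v = scale_colors (-1) (L v)" "0 \<notin> L v"
proof -
  obtain e f where ef: "edges_between G v w = {e, f}" "sign G e = 1" "sign G f = -1"
    using critical_double_edge[OF assms(1,3-5)] by blast
  have rm: "conn G (W - {v})" "conn G (W - {w})" using assms by (auto simp: two_conn_def)
  show eq: "L v = L w"
    using critical_lists_eq[OF assms(1,3,4) rm, of e] ef by (simp add: scale_colors_def)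
  show "L v = scale_colors (-1) (L v)"
    using critical_lists_eq[OF assms(1,3,4) rm, of f] ef eq by simp
  have "w \<noteq> v" using assms(5) mult_refl[of v] by auto
  show "0 \<notin> L v"
  proof
    assume "0 \<in> L v"
    then have inj: "inj_on (\<lambda>e. sign G e * 0) {e, f}"
      using critical_forced_colors(2)[OF assms(1,3) rm(1) _ assms(4) \<open>w \<noteq> v\<close>, of 0] ef by simp
    have "e = f" using inj_onD[OF inj, of e f] by simp
    then show False using ef(2,3) by simp
  qed
qed

text \<open>A symmetric list without 0 has even size, which is the common degree of the
  block.\<close>

lemma critical_even_degree:
  assumes "critical G W L" "two_conn G W" "v \<in> W" "w \<in> W" "mult G v w = 2" "x \<in> W"
  shows "even (deg_in G W x)"
proof -
  have "even (card (L v))"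
    using even_card_symmetric[of "L v"] critical_double_edge_lists[OF assms(1-5)]
      critical_card(1)[OF assms(1,3)] by blast
  then show ?thesis
    using critical_card(2)[OF assms(1,3)] critical_invariant_deg[OF assms(1,2,3,6)] by simp
qed

text \<open>In the triangle, \<open>y\<close> and \<open>z\<close> have equal degrees; cancelling
  the multiplicity between them leaves the claim.\<close>

lemma critical_clique_mult:
  assumes cr: "critical G V L"
    and clique: "\<And>x y. x \<in> V \<Longrightarrow> y \<in> V \<Longrightarrow> x \<noteq> y \<Longrightarrow> adjacent G x y"
    and xyz: "x \<in> V" "y \<in> V" "z \<in> V" "x \<noteq> y" "x \<noteq> z"
  shows "mult G x y = mult G x z"
proof (cases "y = z")
  case False
  let ?T = "{x, y, z}"
  have sub: "?T \<subseteq> V" using xyz by simp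
  have two: "two_conn G ?T"
    unfolding two_conn_def by (intro conjI ballI conn_clique) (use clique sub in auto)
  obtain L' where L': "critical G ?T L'"
    using critical_hereditary[OF cr sub] two by (auto simp: two_conn_def)
  have "deg_in G ?T y = deg_in G ?T z" by (rule critical_invariant_deg[OF L' two]) auto
  then show ?thesis
    using xyz False mult_commute[of G x y] mult_commute[of G x z] mult_commute[of G z y]
    by (simp add: deg_in_def mult_refl)
qed simp

lemma critical_clique_mult_uniform:
  assumes cr: "critical G V L"
    and clique: "\<And>x y. x \<in> V \<Longrightarrow> y \<in> V \<Longrightarrow> x \<noteq> y \<Longrightarrow> adjacent G x y"
    and xy: "x \<in> V" "y \<in> V" "x \<noteq> y" and uv: "u \<in> V" "v \<in> V" "u \<noteq> v"
  shows "mult G u v = mult G x y"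
proof (cases "u = x")
  case True
  then show ?thesis using critical_clique_mult[OF cr clique xy(1) uv(2) xy(2)] uv xy by blast
next
  case False
  have "mult G u v = mult G u x" using critical_clique_mult[OF cr clique uv(1,2) xy(1)] uv False by blast
  also have "\<dots> = mult G x u" by (rule mult_commute)
  also have "\<dots> = mult G x y" using critical_clique_mult[OF cr clique xy(1) uv(1) xy(2)] xy False by blast
  finally show ?thesis .
qed

text \<open>Writing the position as \<open>Suc i\<close> makes the predecessor
  \<open>vs ! i\<close>, without wrapping around. Since the length is at least three, predecessor
  and successor are different vertices.\<close>

lemma cyclic_deg_in:
  assumes vs: "cyclic_list G vs" "chordless G vs" and i: "Suc i < length vs"
  shows "deg_in G (set vs) (vs ! Suc i) =
    mult G (vs ! i) (vs ! Suc i) + mult G (vs ! Suc i) (vs ! (Suc (Suc i) mod length vs))"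
proof -
  let ?n = "length vs" and ?v = "vs ! Suc i" and ?w = "vs ! (Suc (Suc i) mod length vs)"
  have n: "?n \<ge> 3" and d: "distinct vs" using vs by (auto simp: cyclic_list_def)
  have k: "Suc (Suc i) mod ?n < ?n" using i by (auto intro: mod_less_divisor)
  have "Suc (Suc i) mod ?n \<noteq> i" using n i by (cases "Suc (Suc i) = ?n") auto
  then have ne: "?w \<noteq> vs ! i" using nth_eq_iff_index_eq[OF d k, of i] i by simp
  have "deg_in G (set vs) ?v = (\<Sum>w\<in>{vs ! i, ?w}. mult G ?v w)"
    unfolding deg_in_def
  proof (rule sum.mono_neutral_right)
    show "\<forall>w\<in>set vs - {vs ! i, ?w}. mult G ?v w = 0"
    proof
      fix w assume w: "w \<in> set vs - {vs ! i, ?w}"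
      then obtain j where j: "j < ?n" "w = vs ! j" by (auto simp: in_set_conv_nth)
      have "\<not> adjacent G ?v w"
      proof
        assume "adjacent G ?v w"
        then have "j = Suc (Suc i) mod ?n \<or> Suc i = Suc j mod ?n"
          using vs(2) i j by (auto simp: chordless_def)
        moreover have "Suc i = Suc j mod ?n \<Longrightarrow> j = i"
          using j by (cases "Suc j = ?n") auto
        ultimately show False using w j by auto
      qed
      then show "mult G ?v w = 0" by (simp add: adjacent_iff_mult)
    qed
  qed (use i k in auto)
  then show ?thesis using ne mult_commute[of G ?v "vs ! i"] by simp
qed

text \<open>One double edge makes all degrees even, so consecutive multiplicities have the same
  parity all along the cycle. As they are 1 or 2, all are 2.\<close>

lemma critical_cycle_mult_uniform:
  assumes cr: "critical G (set vs) L" and vs: "cyclic_list G vs" "chordless G vs"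
    and k: "k < length vs" "mult G (vs ! k) (vs ! (Suc k mod length vs)) = 2" and i: "i < length vs"
  shows "mult G (vs ! i) (vs ! (Suc i mod length vs)) = 2"
proof -
  let ?n = "length vs"
  define m where "m i = mult G (vs ! i) (vs ! (Suc i mod ?n))" for i
  have lt: "Suc i mod ?n < ?n" for i using k by (auto intro: mod_less_divisor)
  have even_deg: "even (deg_in G (set vs) x)" if "x \<in> set vs" for x
    using critical_even_degree[OF cr cyclic_list_two_conn[OF vs(1)] _ _ k(2) that] k(1) lt by simp
  have step: "even (m (Suc i)) \<longleftrightarrow> even (m i)" if "Suc i < ?n" for i
    using cyclic_deg_in[OF vs that] even_deg[of "vs ! Suc i"] that by (auto simp: m_def)
  have "even (m i) \<longleftrightarrow> even (m 0)" if "i < ?n" for i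
    using that by (induction i) (use step in auto)
  then have "even (m i)" using k i by (metis even_numeral m_def)
  then show ?thesis
    using critical_mult_cases[OF cr _ _ cyclic_list_adjacent[OF vs(1) i]] i lt[of i]
    by (auto simp: m_def)
qed

text \<open>Without chords only consecutive positions constrain each other. Checking each edge in
  the forward direction suffices because signs are their own inverses.\<close>

lemma colorable_on_cycle:
  assumes d: "distinct vs" and ch: "chordless G vs"
    and f: "\<And>i. i < length vs \<Longrightarrow> f i \<in> L (vs ! i)"
    and ok: "\<And>i e. i < length vs \<Longrightarrow> e \<in> edges_between G (vs ! i) (vs ! (Suc i mod length vs)) \<Longrightarrow>
      f i \<noteq> sign G e * f (Suc i mod length vs)"
  shows "colorable_on G (set vs) L"
proof -
  let ?n = "length vs"
  define \<phi> where "\<phi> v = f (the_inv_into {..<?n} ((!) vs) v)" for v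
  have \<phi>: "\<phi> (vs ! i) = f i" if "i < ?n" for i
    using that d by (simp add: \<phi>_def the_inv_into_f_f inj_on_nth)
  have "proper_on G (set vs) \<phi>"
    unfolding proper_on_def
  proof (intro ballI)
    fix v w e assume v: "v \<in> set vs" and w: "w \<in> set vs" and e: "e \<in> edges_between G v w"
    obtain i j where i: "i < ?n" "v = vs ! i" and j: "j < ?n" "w = vs ! j"
      using v w by (auto simp: in_set_conv_nth)
    have eG: "e \<in> edges G" using edges_betweenD[OF e] by blast
    have "adjacent G v w" using e by (auto simp: adjacent_def)
    then consider "j = Suc i mod ?n" | "i = Suc j mod ?n" using ch i j by (auto simp: chordless_def)
    then show "\<phi> v \<noteq> sign G e * \<phi> w"
    proof cases
      case 1
      then show ?thesis using ok[of i e] e i j \<phi> by simp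
    next
      case 2
      then have "f j \<noteq> sign G e * f i" using ok[of j e] e i j edges_between_commute[of G v w] by simp
      then show ?thesis using \<phi> i j sign_mult_self[OF eG, of "f j"] by auto
    qed
  qed
  moreover have "\<forall>v\<in>set vs. \<phi> v \<in> L v" using \<phi> f by (auto simp: in_set_conv_nth)
  ultimately show ?thesis unfolding colorable_on_def by blast
qed

text \<open>The partial sign products \<open>t\<close> switch the cycle: multiplying the color at
  position \<open>i\<close> by \<open>t i\<close> makes every edge but the closing one behave like a
  positive edge. Alternating two colors of the first list can then fail only at the closing edge,
  and since it must fail, the total sign is determined by the parity of the length.\<close>

lemma critical_cycle_parity:
  assumes cr: "critical G (set vs) L" and vs: "cyclic_list G vs" "chordless G vs"
    and E: "\<And>i. i < length vs \<Longrightarrow> edges_between G (vs ! i) (vs ! (Suc i mod length vs)) = {E i}"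
  shows "(\<Prod>i<length vs. sign G (E i)) = (if odd (length vs) then 1 else -1)"
proof -
  let ?n = "length vs"
  define t where "t i = (\<Prod>j<i. sign G (E j))" for i
  have n: "?n \<ge> 3" and d: "distinct vs" using vs by (auto simp: cyclic_list_def)
  have lt: "Suc i mod ?n < ?n" for i using n by (intro mod_less_divisor) linarith
  have EG: "E i \<in> edges G" if "i < ?n" for i using E[OF that] edges_betweenD by blast
  have t_unit: "t i = 1 \<or> t i = -1" if "i \<le> ?n" for i
    unfolding t_def by (rule prod_unit) (use sign_values EG that in auto)
  have t_Suc: "t (Suc i) = sign G (E i) * t i" for i by (simp add: t_def)
  have rm: "conn G (set vs - {v})" if "v \<in> set vs" for v
    using cyclic_list_two_conn[OF vs(1)] that by (auto simp: two_conn_def)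
  have step: "sign G (E i) * c \<in> L (vs ! (Suc i mod ?n))" if i: "i < ?n" and c: "c \<in> L (vs ! i)" for i c
  proof -
    have "vs ! (Suc i mod ?n) \<noteq> vs ! i"
      using cyclic_list_adjacent[OF vs(1) i] adjacent_irrefl by metis
    then show ?thesis
      using critical_forced_colors(1)[OF cr _ rm c, of "vs ! (Suc i mod ?n)"] E[OF i] i lt[of i] by simp
  qed
  \<comment> \<open>The index is taken modulo the length so that \<open>i = length vs\<close>
    returns to the start: the first list is closed under multiplication by the total sign.\<close>
  have in_L: "t i * c \<in> L (vs ! (i mod ?n))" if "c \<in> L (vs ! 0)" "i \<le> ?n" for i c
    using that(2)
  proof (induction i)
    case 0
    then show ?case using that by (simp add: t_def)
  next
    case (Suc i)
    then show ?case using step[of i "t i * c"] by (simp add: t_Suc mult.assoc)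
  qed
  have not_both: False
    if ab: "a \<in> L (vs ! 0)" "b \<in> L (vs ! 0)" "a \<noteq> b"
      \<comment> \<open>The last position carries \<open>b\<close> for even length and
        \<open>a\<close> for odd length; \<open>close\<close> says that the closing edge is
        respected.\<close>
      and close: "(if even ?n then b else a) \<noteq> t ?n * a" for a b
  proof -
    define x where "x i = (if even i then a else b)" for i :: nat
    have "colorable_on G (set vs) L"
    proof (rule colorable_on_cycle[OF d vs(2), of "\<lambda>i. t i * x i"])
      fix i assume i: "i < ?n"
      then show "t i * x i \<in> L (vs ! i)" using in_L[of "x i" i] ab by (simp add: x_def)
      fix e assume e: "e \<in> edges_between G (vs ! i) (vs ! (Suc i mod ?n))"
      then have [simp]: "e = E i" using E[OF i] by simp
      show "t i * x i \<noteq> sign G e * (t (Suc i mod ?n) * x (Suc i mod ?n))"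
      proof (cases "Suc i = ?n")
        case True
        have "t i * x i \<noteq> sign G (E i) * a"
        proof
          assume *: "t i * x i = sign G (E i) * a"
          have "x i = t i * (t i * x i)" using t_unit[of i] i by auto
          also have "\<dots> = t ?n * a" using * True t_Suc[of i] by simp
          finally have "x i = t ?n * a" .
          moreover have "even i \<longleftrightarrow> odd ?n" using True by (metis even_Suc)
          ultimately show False using close by (cases "even ?n") (simp_all add: x_def)
        qed
        then show ?thesis using True by (simp add: t_def x_def)
      next
        case False
        then have m: "Suc i mod ?n = Suc i" using i by simp
        have t: "sign G (E i) * (t (Suc i) * x (Suc i)) = t i * x (Suc i)"
          using sign_mult_self[OF EG[OF i], of "t i * x (Suc i)"] by (simp add: t_Suc mult.assoc)
        have "x i \<noteq> x (Suc i)" using ab by (auto simp: x_def)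
        then show ?thesis unfolding \<open>e = E i\<close> m t using t_unit[of i] i by auto
      qed
    qed
    then show False using criticalD(6)[OF cr] by blast
  qed
  let ?C = "L (vs ! 0)"
  have v0: "vs ! 0 \<in> set vs" using n by (intro nth_mem) linarith
  have "card ?C \<ge> 2"
  proof -
    have "vs ! 1 \<in> set vs" using n by (intro nth_mem) linarith
    moreover have n01: "0 < ?n" "Suc 0 < ?n" using n by linarith+
    then have "deg_in G (set vs) (vs ! 1) = 2"
      using cyclic_deg_in[OF vs n01(2)] E[OF n01(1)] E[OF n01(2)] by (simp add: mult_def)
    ultimately have "deg_in G (set vs) (vs ! 0) = 2"
      using critical_invariant_deg[OF cr cyclic_list_two_conn[OF vs(1)] _ v0, of "vs ! 1"] by simp
    then show ?thesis using critical_card(2)[OF cr v0] by simp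
  qed
  \<comment> \<open>The color \<open>a\<close> is chosen nonzero so that \<open>a\<close> and
    \<open>- a\<close> differ when the total sign is -1; then \<open>- a\<close> serves as the
    second color.\<close>
  then obtain a b where ab: "a \<in> ?C" "b \<in> ?C" "a \<noteq> b" "a \<noteq> 0"
    by (metis card_2_iff' card_le_Suc0_iff_eq critical_card(1)[OF cr v0] not_less_eq_eq numeral_2_eq_2)
  consider "t ?n = 1" | "t ?n = -1" using t_unit by blast
  then show ?thesis
  proof cases
    case 1
    then show ?thesis using not_both[OF ab(1-3)] ab by (auto simp: t_def)
  next
    case 2
    have "- a \<in> ?C" using in_L[OF ab(1), of ?n] 2 by simp
    moreover have "a \<noteq> - a" using ab(4) by simp
    ultimately have "even ?n" using not_both[OF ab(1), of "- a"] 2 by (cases "even ?n") auto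
    then show ?thesis using 2 by (simp add: t_def)
  qed
qed

text \<open>All lists equal one set of four colors, which contains some \<open>a\<close> and a
  \<open>b\<close> different from \<open>a\<close> and \<open>- a\<close>. Such colors respect edges
  of both signs, so alternating them would color an even cycle.\<close>

lemma critical_double_cycle_odd:
  assumes cr: "critical G (set vs) L" and vs: "cyclic_list G vs" "chordless G vs"
    and double: "\<And>i. i < length vs \<Longrightarrow> mult G (vs ! i) (vs ! (Suc i mod length vs)) = 2"
  shows "odd (length vs)"
proof
  assume even: "even (length vs)"
  let ?n = "length vs" and ?C = "L (vs ! 0)"
  have n: "?n \<ge> 3" and d: "distinct vs" using vs by (auto simp: cyclic_list_def)
  have lt: "Suc i mod ?n < ?n" for i using n by (intro mod_less_divisor) linarith
  note two = cyclic_list_two_conn[OF vs(1)]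
  have C: "L (vs ! i) = ?C" if "i < ?n" for i
    using that
  proof (induction i)
    case (Suc i)
    then show ?case
      using critical_double_edge_lists(1)[OF cr two _ _ double[of i]] by simp
  qed simp
  have in_set: "vs ! 0 \<in> set vs" "vs ! 1 \<in> set vs" using n by (intro nth_mem; linarith)+
  have n01: "0 < ?n" "Suc 0 < ?n" using n by linarith+
  have "deg_in G (set vs) (vs ! 1) = 4"
    using cyclic_deg_in[OF vs n01(2)] double[OF n01(1)] double[OF n01(2)] n01 by simp
  then have "deg_in G (set vs) (vs ! 0) = 4"
    using critical_invariant_deg[OF cr two in_set(2,1)] by simp
  then have card: "card ?C = 4" using critical_card(2)[OF cr in_set(1)] by simp
  then obtain a where a: "a \<in> ?C" by fastforce
  have "\<not> ?C \<subseteq> {a, - a}"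
  proof
    assume "?C \<subseteq> {a, - a}"
    then have "card ?C \<le> card {a, - a}" by (intro card_mono) auto
    also have "\<dots> \<le> 2" by (simp add: card_insert_if)
    finally show False using card by simp
  qed
  then obtain b where b: "b \<in> ?C" "b \<noteq> a" "b \<noteq> - a" by blast
  have "colorable_on G (set vs) L"
  proof (rule colorable_on_cycle[OF d vs(2), of "\<lambda>i. if even i then a else b"])
    fix i assume i: "i < ?n"
    then show "(if even i then a else b) \<in> L (vs ! i)" using C a b by simp
    fix e assume "e \<in> edges_between G (vs ! i) (vs ! (Suc i mod ?n))"
    then have s: "sign G e = 1 \<or> sign G e = -1" using sign_values edges_betweenD by blast
    have "even (Suc i mod ?n) \<longleftrightarrow> odd i" using even i by (cases "Suc i = ?n") (simp_all, metis even_Suc)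
    then show "(if even i then a else b) \<noteq> sign G e * (if even (Suc i mod ?n) then a else b)"
      using s b by auto
  qed
  then show False using criticalD(6)[OF cr] by blast
qed

end

section \<open>Bricks\<close>

context signed_graph
begin

lemma edge_ends:
  assumes "e \<in> edges G"
  obtains v w where "ends G e = {v, w}" "v \<noteq> w" "v \<in> verts G" "w \<in> verts G"
    "e \<in> edges_between G v w" "adjacent G v w"
proof -
  obtain v w where vw: "ends G e = {v, w}" "v \<noteq> w" using card_ends[OF assms] by (meson card_2_iff)
  then have "e \<in> edges_between G v w" using assms by (simp add: edges_between_def)
  then show ?thesis using that vw ends_verts[OF assms] by (auto simp: adjacent_def)
qed

lemma underlying_simpleI:
  assumes "\<And>e. e \<in> edges G \<Longrightarrow> ends G e \<in> S"
    and "\<And>A. A \<in> S \<Longrightarrow> \<exists>v w e. A = {v, w} \<and> edges_between G v w = {e}"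
  shows "underlying_simple G S"
  unfolding underlying_simple_def
proof
  show "inj_on (ends G) (edges G)"
  proof (rule inj_onI)
    fix e f assume ef: "e \<in> edges G" "f \<in> edges G" "ends G e = ends G f"
    obtain v w g where vw: "ends G e = {v, w}" "edges_between G v w = {g}"
      using assms(2)[OF assms(1)[OF ef(1)]] by blast
    then have "e \<in> {g}" "f \<in> {g}" using ef by (auto simp: edges_between_def simp flip: vw(2))
    then show "e = f" by simp
  qed
  show "ends G ` edges G = S"
  proof (intro equalityI subsetI)
    fix A assume "A \<in> S"
    then obtain v w e where "A = {v, w}" "edges_between G v w = {e}" using assms(2) by blast
    then show "A \<in> ends G ` edges G" using edges_betweenD[of e v w] by auto
  qed (use assms(1) in auto)
qed

lemma is_doubleI:
  assumes "\<And>e. e \<in> edges G \<Longrightarrow> ends G e \<in> S"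
    and "\<And>A. A \<in> S \<Longrightarrow>
      \<exists>v w e f. A = {v, w} \<and> edges_between G v w = {e, f} \<and> sign G e = 1 \<and> sign G f = -1"
  shows "is_double G S"
  unfolding is_double_def
proof (intro conjI ballI)
  have *: "\<exists>e f. {g \<in> edges G. ends G g = A} = {e, f} \<and> sign G e = 1 \<and> sign G f = -1" if "A \<in> S" for A
    using assms(2)[OF that] by (auto simp: edges_between_def)
  show "ends G ` edges G = S"
  proof (intro equalityI subsetI)
    fix A assume "A \<in> S"
    then obtain e f where "{g \<in> edges G. ends G g = A} = {e, f}" using * by blast
    then have "e \<in> {g \<in> edges G. ends G g = A}" by blast
    then show "A \<in> ends G ` edges G" by blast
  qed (use assms(1) in auto)
  fix A assume "A \<in> S"
  then obtain e f where ef: "{g \<in> edges G. ends G g = A} = {e, f}" "sign G e = 1" "sign G f = -1"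
    using * by blast
  have iff: "g \<in> edges G \<and> ends G g = A \<longleftrightarrow> g = e \<or> g = f" for g using ef(1) by blast
  show "\<exists>!g. g \<in> edges G \<and> ends G g = A \<and> sign G g = 1"
  proof (rule ex1I[of _ e])
    fix g assume g: "g \<in> edges G \<and> ends G g = A \<and> sign G g = 1"
    then have "g = e \<or> g = f" using iff by blast
    then show "g = e" using g ef(3) by auto
  qed (use iff ef(2) in blast)
  show "\<exists>!g. g \<in> edges G \<and> ends G g = A \<and> sign G g = -1"
  proof (rule ex1I[of _ f])
    fix g assume g: "g \<in> edges G \<and> ends G g = A \<and> sign G g = -1"
    then have "g = e \<or> g = f" using iff by blast
    then show "g = f" using g ef(2) by auto
  qed (use iff ef(3) in blast)
qed

lemma ends_complete_edges: "e \<in> edges G \<Longrightarrow> ends G e \<in> complete_edges (verts G)"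
  using ends_verts card_ends by (auto simp: complete_edges_def)

lemma complete_edgesE:
  assumes "A \<in> complete_edges V"
  obtains v w where "A = {v, w}" "v \<in> V" "w \<in> V" "v \<noteq> w"
proof -
  have A: "A \<subseteq> V" "card A = 2" using assms by (auto simp: complete_edges_def)
  obtain v w where "A = {v, w}" "v \<noteq> w" using A(2) by (meson card_2_iff)
  then show ?thesis using that A(1) by blast
qed

section \<open>Complete graphs, cycles and their doubles\<close>

lemma critical_triangle_sign:
  assumes cr: "critical G V L" and xyz: "x \<in> V" "y \<in> V" "z \<in> V" "x \<noteq> y" "y \<noteq> z" "z \<noteq> x"
    and e: "edges_between G x y = {e}" and f: "edges_between G y z = {f}"
    and g: "edges_between G z x = {g}"
  shows "sign G e * sign G f * sign G g = 1"
proof -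
  let ?vs = "[x, y, z]"
  have vs: "cyclic_list G ?vs" using xyz e f g by (simp add: cyclic_list_def adjacent_def)
  have sub: "set ?vs \<subseteq> V" using xyz by simp
  obtain L' where L': "critical G (set ?vs) L'"
    using critical_hereditary[OF cr sub] cyclic_list_two_conn[OF vs] by (auto simp: two_conn_def)
  have "edges_between G (?vs ! i) (?vs ! (Suc i mod length ?vs)) = {[e, f, g] ! i}"
    if "i < length ?vs" for i
  proof -
    have "i = 0 \<or> i = 1 \<or> i = 2" using that by auto
    then show ?thesis using e f g by (elim disjE) simp_all
  qed
  from critical_cycle_parity[OF L' vs chordless_triangle this]
  show ?thesis by (simp add: numeral_3_eq_3 mult.assoc)
qed

text \<open>The signs of the edges at a fixed vertex \<open>x0\<close> serve as a potential. For an
  edge avoiding \<open>x0\<close>, the positive triangle through \<open>x0\<close> gives the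
  required product formula.\<close>

lemma critical_clique_balanced:
  assumes cr: "critical G (verts G) L"
    and simple: "\<And>x y. x \<in> verts G \<Longrightarrow> y \<in> verts G \<Longrightarrow> x \<noteq> y \<Longrightarrow> \<exists>e. edges_between G x y = {e}"
  shows "balanced G"
proof -
  obtain x0 where x0: "x0 \<in> verts G" using criticalD(3)[OF cr] by blast
  define E where "E x y = (THE e. edges_between G x y = {e})" for x y
  have E: "edges_between G x y = {E x y}"
    if xy: "x \<in> verts G" "y \<in> verts G" "x \<noteq> y" for x y
  proof -
    obtain e where "edges_between G x y = {e}" using simple[OF xy] by blast
    then show ?thesis by (simp add: E_def)
  qed
  have EG: "E x y \<in> edges G" if "x \<in> verts G" "y \<in> verts G" "x \<noteq> y" for x y
    using E[OF that] edges_betweenD[of "E x y" x y] by simp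
  \<comment> \<open>The value 1 at \<open>x0\<close> fits the edges there; outside the graph it only
    keeps the potential a unit.\<close>
  define s where "s v = (if v \<in> verts G \<and> v \<noteq> x0 then sign G (E x0 v) else 1)" for v
  show ?thesis
  proof (rule balanced_if_potential)
    show "s v = 1 \<or> s v = -1" for v using sign_values EG x0 by (auto simp: s_def)
    fix e v w assume e: "e \<in> edges G" and "ends G e = {v, w}"
    then have eb: "e \<in> edges_between G v w" by (simp add: edges_between_def)
    then have ne: "v \<noteq> w" using edges_between_refl by blast
    have vw: "v \<in> verts G" "w \<in> verts G" using \<open>ends G e = {v, w}\<close> ends_verts[OF e] by auto
    have ev: "E v w = e" using E[OF vw ne] eb by simp
    consider "v = x0" | "w = x0" | "v \<noteq> x0" "w \<noteq> x0" by blast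
    then show "sign G e = s v * s w"
    proof cases
      case 1
      then show ?thesis using ev ne vw by (simp add: s_def)
    next
      case 2
      then have "E x0 v = e" using eb E[of x0 v] vw ne edges_between_commute[of G v w] by simp
      then show ?thesis using 2 ne vw by (simp add: s_def)
    next
      case 3
      have "edges_between G w x0 = {E x0 w}"
        using E[OF x0 vw(2)] 3 edges_between_commute[of G w x0] by simp
      then have "sign G (E x0 v) * sign G e * sign G (E x0 w) = 1"
        using critical_triangle_sign[OF cr x0 vw, of "E x0 v" e "E x0 w"] E[OF x0 vw(1)] E[OF vw ne] ev 3 ne
        by simp
      moreover have "sign G e = 1 \<or> sign G e = -1" "sign G (E x0 v) = 1 \<or> sign G (E x0 v) = -1"
        "sign G (E x0 w) = 1 \<or> sign G (E x0 w) = -1"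
        using sign_values e EG x0 vw 3 by auto
      ultimately show ?thesis using 3 vw by (auto simp: s_def)
    qed
  qed
qed

text \<open>By uniformity one double edge makes every edge double. Otherwise all edges are simple
  and the signs are balanced; a single vertex falls under this second case.\<close>

lemma critical_clique_brick:
  assumes cr: "critical G (verts G) L"
    and clique: "\<And>x y. x \<in> verts G \<Longrightarrow> y \<in> verts G \<Longrightarrow> x \<noteq> y \<Longrightarrow> adjacent G x y"
  shows "brick G"
proof (cases "\<exists>x\<in>verts G. \<exists>y\<in>verts G. x \<noteq> y \<and> mult G x y = 2")
  case True
  then obtain x y where xy: "x \<in> verts G" "y \<in> verts G" "x \<noteq> y" "mult G x y = 2" by blast
  have "mult G u v = 2" if "u \<in> verts G" "v \<in> verts G" "u \<noteq> v" for u v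
    using critical_clique_mult_uniform[OF cr clique xy(1-3) that] xy(4) by simp
  then have double: "\<exists>e f. edges_between G u v = {e, f} \<and> sign G e = 1 \<and> sign G f = -1"
    if "u \<in> verts G" "v \<in> verts G" "u \<noteq> v" for u v
    using critical_double_edge[OF cr that(1,2)] that by metis
  have "is_double G (complete_edges (verts G))"
  proof (rule is_doubleI)
    fix A assume "A \<in> complete_edges (verts G)"
    then obtain v w where vw: "A = {v, w}" "v \<in> verts G" "w \<in> verts G" "v \<noteq> w" by (rule complete_edgesE)
    then show "\<exists>v w e f. A = {v, w} \<and> edges_between G v w = {e, f} \<and> sign G e = 1 \<and> sign G f = -1"
      using double[OF vw(2-4)] by blast
  qed (rule ends_complete_edges)
  moreover have "card {x, y} \<le> card (verts G)" using xy finite_verts by (intro card_mono) auto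
  then have "card (verts G) \<ge> 2" using xy by simp
  ultimately show ?thesis
    using signed_graph_axioms by (auto simp: brick_def is_double_complete_def)
next
  case False
  have simple: "\<exists>e. edges_between G x y = {e}" if "x \<in> verts G" "y \<in> verts G" "x \<noteq> y" for x y
    using critical_mult_cases[OF cr that(1,2) clique[OF that]] False that by auto
  have "underlying_simple G (complete_edges (verts G))"
  proof (rule underlying_simpleI)
    fix A assume "A \<in> complete_edges (verts G)"
    then obtain v w where vw: "A = {v, w}" "v \<in> verts G" "w \<in> verts G" "v \<noteq> w" by (rule complete_edgesE)
    then show "\<exists>v w e. A = {v, w} \<and> edges_between G v w = {e}" using simple[OF vw(2-4)] by blast
  qed (rule ends_complete_edges)
  moreover have "card (verts G) \<ge> 1"
    using criticalD(3)[OF cr] finite_verts by (simp add: Suc_leI card_gt_0_iff)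
  ultimately show ?thesis
    using signed_graph_axioms critical_clique_balanced[OF cr simple]
    by (auto simp: brick_def is_complete_def)
qed

lemma chordless_edge_index:
  assumes vs: "chordless G vs" "set vs = verts G" and e: "e \<in> edges G"
  obtains i where "i < length vs" "e \<in> edges_between G (vs ! i) (vs ! (Suc i mod length vs))"
proof -
  obtain v w where vw: "v \<in> verts G" "w \<in> verts G" "e \<in> edges_between G v w" "adjacent G v w"
    using edge_ends[OF e] by blast
  obtain i j where ij: "i < length vs" "v = vs ! i" "j < length vs" "w = vs ! j"
    using vw vs(2) by (metis in_set_conv_nth)
  then have "j = Suc i mod length vs \<or> i = Suc j mod length vs"
    using vs(1) vw(4) by (auto simp: chordless_def)
  then show ?thesis
  proof
    assume "j = Suc i mod length vs"
    then show ?thesis using that[of i] ij vw(3) by simp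
  next
    assume "i = Suc j mod length vs"
    then show ?thesis using that[of j] ij vw(3) edges_between_commute[of G v w] by simp
  qed
qed

lemma critical_cycle_brick:
  assumes cr: "critical G (verts G) L" and vs: "cyclic_list G vs" "chordless G vs" "set vs = verts G"
  shows "brick G"
proof -
  let ?n = "length vs"
  have n: "?n \<ge> 3" and d: "distinct vs" using vs by (auto simp: cyclic_list_def)
  have lt: "Suc i mod ?n < ?n" for i using n by (intro mod_less_divisor) linarith
  have in_V: "vs ! i \<in> verts G" if "i < ?n" for i using nth_mem[OF that] vs(3) by simp
  have cr': "critical G (set vs) L" using cr vs(3) by simp
  show ?thesis
  proof (cases "\<exists>k<?n. mult G (vs ! k) (vs ! (Suc k mod ?n)) = 2")
    case True
    then have double: "mult G (vs ! i) (vs ! (Suc i mod ?n)) = 2" if "i < ?n" for i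
      using critical_cycle_mult_uniform[OF cr' vs(1,2)] that by blast
    have "is_double G (cycle_edges vs)"
    proof (rule is_doubleI)
      fix e assume "e \<in> edges G"
      then obtain i where "i < ?n" "e \<in> edges_between G (vs ! i) (vs ! (Suc i mod ?n))"
        by (rule chordless_edge_index[OF vs(2,3)])
      then show "ends G e \<in> cycle_edges vs" by (auto simp: edges_between_def cycle_edges_def)
    next
      fix A assume "A \<in> cycle_edges vs"
      then obtain i where i: "i < ?n" "A = {vs ! i, vs ! (Suc i mod ?n)}" by (auto simp: cycle_edges_def)
      then show "\<exists>v w e f. A = {v, w} \<and> edges_between G v w = {e, f} \<and> sign G e = 1 \<and> sign G f = -1"
        using critical_double_edge[OF cr in_V[OF i(1)] in_V[OF lt] double[OF i(1)]] by metis
    qed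
    moreover have "odd ?n" using critical_double_cycle_odd[OF cr' vs(1,2) double] .
    ultimately show ?thesis
      using signed_graph_axioms d vs(3) n by (auto simp: brick_def is_double_cycle_def)
  next
    case False
    define E where "E i = (THE e. edges_between G (vs ! i) (vs ! (Suc i mod ?n)) = {e})" for i
    have E: "edges_between G (vs ! i) (vs ! (Suc i mod ?n)) = {E i}" if i: "i < ?n" for i
    proof -
      obtain e where "edges_between G (vs ! i) (vs ! (Suc i mod ?n)) = {e}"
        using critical_mult_cases[OF cr in_V[OF i] in_V[OF lt] cyclic_list_adjacent[OF vs(1) i]]
          False i by auto
      then show ?thesis by (simp add: E_def)
    qed
    have EG: "E i \<in> edges G" "ends G (E i) = {vs ! i, vs ! (Suc i mod ?n)}" if "i < ?n" for i
      using edges_betweenD[of "E i"] E[OF that] by auto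
    have edge: "\<exists>i<?n. e = E i" if "e \<in> edges G" for e
      by (rule chordless_edge_index[OF vs(2,3) that]) (use E in auto)
    let ?es = "map E [0..<?n]"
    have inj: "inj_on E {0..<?n}"
    proof (rule inj_onI)
      fix i j assume "i \<in> {0..<?n}" "j \<in> {0..<?n}" "E i = E j"
      then show "i = j" using cyclic_edge_determines_index[OF d n, of i j] EG(2)[of i] EG(2)[of j] by simp
    qed
    have cyc: "is_cycle_in G vs ?es"
      unfolding is_cycle_in_def using n d inj EG by (auto simp: distinct_map)
    have "edges G \<subseteq> E ` {0..<?n}" using edge by fastforce
    then have "set ?es = edges G" using EG(1) by auto
    then have cycle: "is_cycle G ?n" unfolding is_cycle_def using cyc vs(3) by blast
    define t where "t i = (\<Prod>j<i. sign G (E j))" for i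
    have tn: "t ?n = (if odd ?n then 1 else -1)"
      unfolding t_def by (rule critical_cycle_parity[OF cr' vs(1,2) E])
    show ?thesis
    proof (cases "odd ?n")
      case True
      \<comment> \<open>The partial sign product up to the position of \<open>v\<close> is its
        potential.\<close>
      define s where "s v = (if v \<in> set vs then t (the_inv_into {..<?n} ((!) vs) v) else 1)" for v
      have inv: "the_inv_into {..<?n} ((!) vs) (vs ! i) = i" if "i < ?n" for i
        using that d by (simp add: the_inv_into_f_f inj_on_nth)
      have s: "s (vs ! i) = t i" if "i < ?n" for i
        using that inv by (simp add: s_def)
      have t_unit: "t i = 1 \<or> t i = -1" if "i < ?n" for i
        unfolding t_def by (rule prod_unit) (use sign_values EG that in auto)
      have "balanced G"
      proof (rule balanced_if_potential)
        show "s v = 1 \<or> s v = -1" for v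
        proof (cases "v \<in> set vs")
          case True
          then obtain i where "i < ?n" "v = vs ! i" by (auto simp: in_set_conv_nth)
          then show ?thesis using s t_unit by simp
        qed (simp add: s_def)
        have step: "sign G (E i) = s (vs ! i) * s (vs ! (Suc i mod ?n))" if i: "i < ?n" for i
        proof -
          \<comment> \<open>Odd length gives total sign 1, which equals the empty product
            \<open>t 0\<close>, so the potential also fits the closing edge.\<close>
          have "t (Suc i) = t (Suc i mod ?n)"
            using tn True i by (cases "Suc i = ?n") (simp_all add: t_def)
          then have "s (vs ! i) * s (vs ! (Suc i mod ?n)) = t i * t (Suc i)" using s i lt by simp
          also have "\<dots> = sign G (E i)" using t_unit[OF i] by (auto simp: t_def)
          finally show ?thesis by simp
        qed
        fix e v w assume e: "e \<in> edges G" "ends G e = {v, w}"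
        then obtain i where i: "i < ?n" "e = E i" using edge by blast
        then have "{v, w} = {vs ! i, vs ! (Suc i mod ?n)}" using e EG(2) by simp
        then show "sign G e = s v * s w" using step[OF i(1)] i(2) by (auto simp: doubleton_eq_iff mult.commute)
      qed
      then show ?thesis using signed_graph_axioms cycle True by (auto simp: brick_def)
    next
      case False
      \<comment> \<open>For even length the graph itself is a cycle of sign product -1.\<close>
      have "(\<Prod>e\<in>set ?es. sign G e) = t ?n"
        unfolding cycle_sign_product[OF cyc] t_def by (rule prod.cong) auto
      then have "(\<Prod>e\<in>set ?es. sign G e) \<noteq> 1" using tn False by simp
      then have "\<not> balanced G" using cyc unfolding balanced_def by blast
      then show ?thesis using signed_graph_axioms cycle False by (auto simp: brick_def)
    qed
  qed
qed

lemma critical_block_brick: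
  assumes cr: "critical G (verts G) L" and two: "two_conn G (verts G)"
  shows "brick G"
proof (cases "card (verts G) \<ge> 3")
  case True
  then show ?thesis
    using critical_complete_or_cycle[OF cr two] critical_clique_brick[OF cr] critical_cycle_brick[OF cr]
    by blast
next
  case False
  show ?thesis
  proof (rule critical_clique_brick[OF cr])
    fix x y assume xy: "x \<in> verts G" "y \<in> verts G" "x \<noteq> y"
    have "card {x, y} = 2" using xy by simp
    then have V: "verts G = {x, y}"
      using card_seteq[OF finite_verts, of "{x, y}"] xy False by simp
    have ne: "verts G \<noteq> {x}" using xy by auto
    obtain w where "w \<in> verts G" "w \<noteq> x" "adjacent G x w"
      by (rule conn_neighbor[OF criticalD(4)[OF cr] xy(1) ne])
    then show "adjacent G x y" using V by auto
  qed
qed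

section \<open>From uncolorable pairs to the bricks of their blocks\<close>

lemma critical_if_uncolorable_pair:
  assumes "uncolorable_pair G L"
  shows "critical G (verts G) L"
proof -
  have "list_colorable G L" if col: "colorable_on G (verts G) L"
  proof -
    obtain \<phi> where \<phi>: "proper_on G (verts G) \<phi>" "\<forall>v\<in>verts G. \<phi> v \<in> L v"
      using col by (auto simp: colorable_on_def)
    have "coloring G \<phi>"
      unfolding coloring_def
    proof (intro ballI allI impI)
      fix e v w assume e: "e \<in> edges G" "ends G e = {v, w}"
      then have "v \<in> verts G" "w \<in> verts G" "e \<in> edges_between G v w"
        using ends_verts[OF e(1)] by (auto simp: edges_between_def)
      then show "\<phi> v \<noteq> sign G e * \<phi> w" using \<phi>(1) by (auto simp: proper_on_def)
    qed
    then show ?thesis using \<phi>(2) by (auto simp: list_colorable_def list_coloring_def)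
  qed
  then show ?thesis
    using assms by (auto simp: uncolorable_pair_def critical_def connected_iff_conn
        large_lists_def degree_eq_deg_in)
qed

text \<open>Adding to \<open>B\<close> all edges of \<open>G\<close> inside its vertex set creates
  no separating vertex, so by maximality they are already there. Blocks are thus induced subgraphs,
  to which statements about vertex sets apply.\<close>

lemma block_of_edges:
  assumes B: "block_of B G"
  shows "signed_graph B" "edges B = {e \<in> edges G. ends G e \<subseteq> verts B}"
proof -
  have sub: "subgraph B G" and blk: "is_block B"
    and max: "\<And>H. subgraph H G \<Longrightarrow> is_block H \<Longrightarrow> subgraph B H \<Longrightarrow> H = B"
    using B by (auto simp: block_of_def)
  define H where "H = B\<lparr>edges := {e \<in> edges G. ends G e \<subseteq> verts B}\<rparr>"
  have fin: "finite (verts B)" "finite (edges B)"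
    using sub finite_verts finite_edges finite_subset by (auto simp: subgraph_def)
  show sgB: "signed_graph B"
    using sub fin card_ends sign_values by unfold_locales (auto simp: subgraph_def subset_iff)
  have sgH: "signed_graph H"
    using sub fin card_ends sign_values finite_edges
    by unfold_locales (auto simp: subgraph_def H_def)
  have HV: "verts H = verts B" and HE: "ends H = ends B" by (simp_all add: H_def)
  have eB: "edges B \<subseteq> edges H" using sub unfolding subgraph_def H_def by fastforce
  have adj: "adjacent H a b" if "adjacent B a b" for a b
    using that eB HE by (auto simp: adjacent_def edges_between_def)
  have "two_conn B (verts B)" using blk signed_graph.is_block_iff_two_conn[OF sgB] by blast
  then have "two_conn H (verts H)"
    unfolding two_conn_def HV using conn_mono_edges[of B _ H] adj by blast
  then have "is_block H" using signed_graph.is_block_iff_two_conn[OF sgH] by blast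
  moreover have "subgraph H G" "subgraph B H"
    using sub eB by (auto simp: subgraph_def H_def)
  ultimately have "H = B" using max by blast
  then show "edges B = {e \<in> edges G. ends G e \<subseteq> verts B}" by (metis H_def sgraph.select_convs(2) sgraph.update_convs(2) sgraph.surjective)
qed

lemma block_brick:
  assumes cr: "critical G (verts G) L" and B: "block_of B G"
  shows "brick B"
proof -
  note sgB = block_of_edges(1)[OF B]
  have sub: "verts B \<subseteq> verts G" "ends B = ends G" "sign B = sign G" and blk: "is_block B"
    using B by (auto simp: block_of_def subgraph_def)
  have eb: "edges_between B v w = edges_between G v w" if "v \<in> verts B" "w \<in> verts B" for v w
    using that sub by (auto simp: edges_between_def block_of_edges(2)[OF B])
  then have adj: "adjacent B v w \<longleftrightarrow> adjacent G v w" if "v \<in> verts B" "w \<in> verts B" for v w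
    using that by (simp add: adjacent_def)
  have two: "two_conn B (verts B)" using blk signed_graph.is_block_iff_two_conn[OF sgB] by blast
  then have "conn G (verts B)" using conn_mono_edges[of B "verts B" G] adj by (auto simp: two_conn_def)
  then obtain L' where L': "critical G (verts B) L'"
    using critical_hereditary[OF cr sub(1)] two by (auto simp: two_conn_def)
  have "deg_in B (verts B) v = deg_in G (verts B) v" if "v \<in> verts B" for v
    unfolding deg_in_def mult_def by (rule sum.cong) (use eb that in auto)
  then have "critical B (verts B) L'"
    using L' two eb sub
    by (auto simp: critical_def two_conn_def large_lists_def colorable_on_def proper_on_def)
  then show ?thesis using signed_graph.critical_block_brick[OF sgB] two by blast
qed

section \<open>The color lists of a block\<close>

lemma critical_block_lists_positive:
  assumes cr: "critical G (verts G) L"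
    and lists: "\<And>e v w. e \<in> edges_between G v w \<Longrightarrow> L v = scale_colors (sign G e) (L w)"
    and pos: "\<forall>e\<in>edges G. sign G e = 1"
  shows "\<exists>C. \<forall>v\<in>verts G. L v = C"
proof -
  obtain x where x: "x \<in> verts G" using criticalD(3)[OF cr] by blast
  have "L y = L x" if "y \<in> verts G" for y
  proof (rule conn_invariant[OF criticalD(4)[OF cr] x, of "\<lambda>y. L y = L x"])
    fix a b assume "L a = L x" "adjacent G a b"
    then obtain e where "e \<in> edges_between G a b" by (auto simp: adjacent_def)
    then show "L b = L x" using lists pos edges_betweenD \<open>L a = L x\<close> by (fastforce simp: scale_colors_def)
  qed (use that in auto)
  then show ?thesis by blast
qed

text \<open>Along edges a list is kept or negated, so each is \<open>C\<close> or its negative for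
  the list \<open>C\<close> of one vertex. If these two sets coincide, the common list is symmetric.
  If not, the list tells the part of a vertex, and an edge is negative exactly when the lists of its
  ends differ.\<close>

lemma critical_block_lists_signed:
  assumes cr: "critical G (verts G) L"
    and lists: "\<And>e v w. e \<in> edges_between G v w \<Longrightarrow> L v = scale_colors (sign G e) (L w)"
  shows "(\<exists>C. C = scale_colors (-1) C \<and> (\<forall>v\<in>verts G. L v = C)) \<or>
    (\<exists>X Y C. balanced_with_parts G X Y \<and> (\<forall>v\<in>X. L v = C) \<and> (\<forall>v\<in>Y. L v = scale_colors (-1) C))"
proof -
  obtain x where x: "x \<in> verts G" using criticalD(3)[OF cr] by blast
  let ?C = "L x" and ?D = "scale_colors (-1) (L x)"
  have neg: "scale_colors (-1) ?D = ?C" by (simp add: scale_colors_def image_image)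
  have one: "scale_colors 1 S = S" for S by (simp add: scale_colors_def)
  have all: "L y = ?C \<or> L y = ?D" if "y \<in> verts G" for y
  proof (rule conn_invariant[OF criticalD(4)[OF cr] x, of "\<lambda>y. L y = ?C \<or> L y = ?D"])
    fix a b assume a: "L a = ?C \<or> L a = ?D" and "adjacent G a b"
    then obtain e where e: "e \<in> edges_between G b a"
      using adjacent_commute[of G a b] by (auto simp: adjacent_def)
    then have "sign G e = 1 \<or> sign G e = -1" using sign_values edges_betweenD by blast
    then show "L b = ?C \<or> L b = ?D" using lists[OF e] a one neg by auto
  qed (use that in auto)
  show ?thesis
  proof (cases "?C = ?D")
    case True
    then show ?thesis using all by metis
  next
    case False
    let ?X = "{v \<in> verts G. L v = ?C}" and ?Y = "{v \<in> verts G. L v = ?D}"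
    have "sign G e = -1 \<longleftrightarrow> (\<exists>a\<in>?X. \<exists>b\<in>?Y. ends G e = {a, b})" if e: "e \<in> edges G" for e
    proof
      assume s: "sign G e = -1"
      obtain v w where vw: "ends G e = {v, w}" "v \<in> verts G" "w \<in> verts G" "e \<in> edges_between G v w"
        using edge_ends[OF e] by blast
      have "L v = scale_colors (-1) (L w)" using lists[OF vw(4)] s by simp
      then have "(v \<in> ?X \<and> w \<in> ?Y) \<or> (w \<in> ?X \<and> v \<in> ?Y)"
        using all[OF vw(2)] all[OF vw(3)] vw(2,3) neg False by auto
      moreover have "ends G e = {w, v}" using vw(1) by auto
      ultimately show "\<exists>a\<in>?X. \<exists>b\<in>?Y. ends G e = {a, b}" using vw(1) by blast
    next
      assume "\<exists>a\<in>?X. \<exists>b\<in>?Y. ends G e = {a, b}"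
      then obtain a b where ab: "L a = ?C" "L b = ?D" "ends G e = {a, b}" by blast
      then have "?C = scale_colors (sign G e) ?D" using lists[of e a b] e by (simp add: edges_between_def)
      then show "sign G e = -1" using sign_values[OF e] False one by auto
    qed
    moreover have "?X \<union> ?Y = verts G" using all by blast
    moreover have "v \<notin> ?Y" if "v \<in> ?X" for v using that False by simp
    then have "?X \<inter> ?Y = {}" by blast
    ultimately have "balanced_with_parts G ?X ?Y" unfolding balanced_with_parts_def by blast
    then show ?thesis by blast
  qed
qed

lemma max_multiplicity_attained:
  assumes "verts G \<noteq> {}"
  obtains v w where "v \<in> verts G" "w \<in> verts G" "mult G v w = max_multiplicity G"
proof -
  let ?S = "{card (edges_between G v w) |v w. v \<in> verts G \<and> w \<in> verts G}"
  have "?S = (\<lambda>(v, w). card (edges_between G v w)) ` (verts G \<times> verts G)" by auto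
  then have "finite ?S" using finite_verts by simp
  moreover have "?S \<noteq> {}" using assms by blast
  ultimately have "Max ?S \<in> ?S" by (rule Max_in)
  then show ?thesis using that by (auto simp: max_multiplicity_def mult_def)
qed

end

theorem theorem8:
  fixes G :: "('v, 'e) sgraph" and L :: "'v \<Rightarrow> int set"
  assumes "uncolorable_pair G L"
  shows "(\<forall>v\<in>verts G. finite (L v) \<and> card (L v) = degree G v) \<and>
    (\<forall>v\<in>verts G. \<forall>w\<in>verts G. adjacent G v w \<longrightarrow>
      (\<exists>e. edges_between G v w = {e}) \<or>
      (\<exists>e f. edges_between G v w = {e, f} \<and> sign G e = 1 \<and> sign G f = -1)) \<and>
    (is_block G \<longrightarrow>
      (\<forall>e\<in>edges G. \<forall>v w. ends G e = {v, w} \<longrightarrow> L v = scale_colors (sign G e) (L w)) \<and>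
      ((\<forall>e\<in>edges G. sign G e = 1) \<longrightarrow> (\<exists>C. \<forall>v\<in>verts G. L v = C)) \<and>
      ((\<exists>e\<in>edges G. sign G e = -1) \<longrightarrow>
        (\<exists>C. C = scale_colors (-1) C \<and> (\<forall>v\<in>verts G. L v = C)) \<or>
        (\<exists>X Y C. balanced_with_parts G X Y \<and>
          (\<forall>v\<in>X. L v = C) \<and> (\<forall>v\<in>Y. L v = scale_colors (-1) C))) \<and>
      (\<exists>r. regular G r)) \<and>
    (is_block G \<and> max_multiplicity G \<ge> 2 \<longrightarrow> (\<exists>r\<ge>2. even r \<and> regular G r)) \<and>
    (\<forall>B. block_of B G \<longrightarrow> brick B)"
proof -
  interpret signed_graph G using assms by (simp add: uncolorable_pair_def)
  note cr = critical_if_uncolorable_pair[OF assms]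
  have a: "finite (L v) \<and> card (L v) = degree G v" if "v \<in> verts G" for v
    using critical_card[OF cr that] by (simp add: degree_eq_deg_in)
  have b: "(\<exists>e. edges_between G v w = {e}) \<or>
      (\<exists>e f. edges_between G v w = {e, f} \<and> sign G e = 1 \<and> sign G f = -1)"
    if "v \<in> verts G" "w \<in> verts G" "adjacent G v w" for v w
    using critical_mult_cases[OF cr that] by blast
  have lists: "L v = scale_colors (sign G e) (L w)" if "is_block G" "e \<in> edges_between G v w" for e v w
  proof -
    have "v \<in> verts G" "w \<in> verts G" using that(2) adjacent_verts[of v w] by (auto simp: adjacent_def)
    then show ?thesis
      using critical_lists_eq[OF cr _ _ _ _ that(2)] that(1) by (auto simp: is_block_iff_two_conn two_conn_def)
  qed
  have regular: "\<exists>r. regular G r" if "is_block G"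
  proof -
    obtain x where x: "x \<in> verts G" using criticalD(3)[OF cr] by blast
    have "two_conn G (verts G)" using that is_block_iff_two_conn by simp
    then have "regular G (deg_in G (verts G) x)"
      unfolding regular_def degree_eq_deg_in using critical_invariant_deg[OF cr _ x] by simp
    then show ?thesis by blast
  qed
  have d: "\<exists>r\<ge>2. even r \<and> regular G r" if blk: "is_block G" and \<mu>: "max_multiplicity G \<ge> 2"
  proof -
    obtain v w where vw: "v \<in> verts G" "w \<in> verts G" "mult G v w = max_multiplicity G"
      using max_multiplicity_attained[OF criticalD(3)[OF cr]] by blast
    \<comment> \<open>Multiplicities of adjacent vertices are 1 or 2, so a maximum of at least 2 is
      exactly 2. This double edge gives both the parity of the degree and the bound
      \<open>r \<ge> 2\<close>.\<close>
    then have m: "mult G v w = 2"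
      using critical_mult_cases[OF cr vw(1,2)] \<mu> by (fastforce simp: adjacent_iff_mult)
    obtain r where r: "regular G r" using regular[OF blk] by blast
    then have "deg_in G (verts G) v = r" using vw(1) by (simp add: regular_def degree_eq_deg_in)
    moreover have "even (deg_in G (verts G) v)"
      using critical_even_degree[OF cr _ vw(1,2) m vw(1)] blk by (simp add: is_block_iff_two_conn)
    moreover have "deg_in G (verts G) v \<ge> 2"
      using deg_in_remove[OF finite_verts vw(2), of v] m by simp
    ultimately show ?thesis using r by blast
  qed
  have c: "L v = scale_colors (sign G e) (L w)" if "is_block G" "e \<in> edges G" "ends G e = {v, w}" for e v w
    using lists that by (simp add: edges_between_def)
  note c1 = critical_block_lists_positive[OF cr lists]
  note c2 = critical_block_lists_signed[OF cr lists]
  show ?thesis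
    using a b c c1 c2 regular d block_brick[OF cr] by (intro conjI impI ballI allI) simp_all
qed

end
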